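(* The following polynomials in $\mathbf{k}[z_1,z_2,\dots]$ have the weak interval property: (1) $z^c=\prod_i z_i^{c_i}$ for every quasi-Łukasiewicz vector $c$; (2) $\Delta_+(P)$ for every quasisymmetric polynomial $P(x_1,\dots,x_m)$ (any $m\ge1$); (3) $\Delta_+(\mathfrak{S}_w)$ for every quasi-Łukasiewicz permutation $w$.
   Context: Let $\mathbf{k}$ be a field of characteristic zero and $q\in\mathbf{k}$ not a nontrivial root of unity. The Klyachko algebra $\mathcal{K}$ is the commutative $\mathbf{k}$-algebra generated by $u_i$, $i\in\mathbb{Z}$, with relations $(q+1)u_i^2=qu_iu_{i-1}+u_iu_{i+1}$; $\mathcal{K}_+$ is its quotient by the ideal generated by $u_i$, $i\le0$; it has basis $u_I=\prod_{i\in I}u_i$, $I$ finite subsets of $\mathbb{Z}_{>0}$. $\pi_+:\mathbf{k}[z_1,z_2,\dots]\to\mathcal{K}_+$ sends $z_i\mapsto u_i$. A polynomial $f$ has the weak interval property if every $I$ with nonzero coefficient in the expansion of $\pi_+(f)$ in the basis $\{u_I\}$ is an interval of $\mathbb{Z}$. $\Delta_+:\mathbf{k}[x_1,x_2,\dots]\to\mathbf{k}[z_1,z_2,\dots]$ is the algebra morphism $x_1\mapsto z_1$, $x_i\mapsto z_i-z_{i-1}$ ($i>1$). A nonzero finitely supported $c=(c_1,c_2,\dots)\in\mathbb{N}^{\mathbb{Z}_{>0}}$ is quasi-Łukasiewicz if $\sum_{i=1}^jc_i\ge j$ for all $m_c\le j\le M_c$, where $m_c=\min\{j\ge1:c_j>0,\,c_{j+1}=0\}$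 and $M_c=\max\{j:c_j>0\}$. A permutation $w$ is quasi-Łukasiewicz if for its reduced words $\mathbf{a}$ (equivalently any one of them) the content $\mathrm{cont}(\mathbf{a})$, whose $j$-th entry is the number of occurrences of $j$ in $\mathbf{a}$, is quasi-Łukasiewicz. $\mathfrak{S}_w$ is the Schubert polynomial ($\mathfrak{S}_{w_0}=x_1^{n-1}\cdots x_{n-1}$, $\mathfrak{S}_{ws_i}=\partial_i\mathfrak{S}_w$ when $w(i)>w(i+1)$). *)

theory Defs
  imports Main "HOL-Library.Poly_Mapping" "HOL-Combinatorics.Permutations" "HOL-Combinatorics.Transposition"
begin

text \<open>Polynomials in countably many variables over 'k: a polynomial is a finitely supported
map from monomials (exponent vectors) to coefficients. Variable index i
stands for z_i (resp. x_i); only indices i \<ge> 1 are meaningful.\<close>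

type_synonym 'k kpoly = "(nat \<Rightarrow>\<^sub>0 nat) \<Rightarrow>\<^sub>0 'k"

definition pvar :: "nat \<Rightarrow> 'k::comm_ring_1 kpoly" where
  "pvar i = Poly_Mapping.single (Poly_Mapping.single i 1) 1"

definition pconst :: "'k::comm_ring_1 \<Rightarrow> 'k kpoly" where
  "pconst a = Poly_Mapping.single 0 a"

definition psubst :: "(nat \<Rightarrow> 'k::comm_ring_1 kpoly) \<Rightarrow> 'k kpoly \<Rightarrow> 'k kpoly" where
  "psubst \<sigma> p = (\<Sum>m\<in>Poly_Mapping.keys p. pconst (Poly_Mapping.lookup p m) * (\<Prod>i\<in>Poly_Mapping.keys m. \<sigma> i ^ Poly_Mapping.lookup m i))"

definition zv :: "nat \<Rightarrow> 'k::comm_ring_1 kpoly" where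
  "zv i = (if i = 0 then 0 else pvar i)"

definition delta_plus :: "'k::comm_ring_1 kpoly \<Rightarrow> 'k kpoly" where
  "delta_plus = psubst (\<lambda>i. if i = 0 then 0 else if i = 1 then zv 1 else zv i - zv (i - 1))"

text \<open>Defining relations of K_+ in k[z_1,z_2,...]: (q+1) z_i^2 - q z_i z_{i-1} - z_i z_{i+1},
 i \<ge> 1, with z_0 = 0 (the relations for i \<le> 0 become trivial after killing u_i, i \<le> 0).\<close>
definition klrel :: "'k::comm_ring_1 \<Rightarrow> nat \<Rightarrow> 'k kpoly" where
  "klrel q i = pconst (q + 1) * zv i ^ 2 - pconst q * zv i * zv (i - 1) - zv i * zv (i + 1)"

text \<open>Membership in the ideal J generated by the relations; K_+ = k[z_1,z_2,...]/J and
 pi_+ is the quotient map.\<close>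
definition in_klideal :: "'k::comm_ring_1 \<Rightarrow> 'k kpoly \<Rightarrow> bool" where
  "in_klideal q f \<longleftrightarrow> (\<exists>(g :: nat \<Rightarrow> 'k kpoly) N. f = (\<Sum>i\<in>{1..N}. g i * klrel q i))"

definition zset :: "nat set \<Rightarrow> 'k::comm_ring_1 kpoly" where
  "zset I = (\<Prod>i\<in>I. pvar i)"

definition is_interval :: "nat set \<Rightarrow> bool" where
  "is_interval I \<longleftrightarrow> (\<exists>a b. I = {a..b})"

text \<open>Weak interval property: pi_+(f) is a linear combination of basis elements u_I with
 I an interval (equivalently, since the u_I form a basis, every I with nonzero coefficient
 in the expansion of pi_+(f) is an interval).\<close>
definition weak_interval :: "'k::comm_ring_1 \<Rightarrow> 'k kpoly \<Rightarrow> bool" where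
  "weak_interval q f \<longleftrightarrow> (\<exists>a :: nat set \<Rightarrow> 'k.
     finite {I. a I \<noteq> 0} \<and>
     (\<forall>I. a I \<noteq> 0 \<longrightarrow> finite I \<and> 0 \<notin> I \<and> is_interval I) \<and>
     in_klideal q (f - (\<Sum>I\<in>{I. a I \<noteq> 0}. pconst (a I) * zset I)))"

definition quasi_luk :: "(nat \<Rightarrow> nat) \<Rightarrow> bool" where
  "quasi_luk c \<longleftrightarrow> c 0 = 0 \<and> finite {j. c j \<noteq> 0} \<and> (\<exists>j. c j \<noteq> 0) \<and>
     (let m = (LEAST j. 1 \<le> j \<and> c j > 0 \<and> c (j + 1) = 0);
          M = Max {j. c j > 0}
      in \<forall>j. m \<le> j \<and> j \<le> M \<longrightarrow> (\<Sum>i\<in>{1..j}. c i) \<ge> j)"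

definition sref :: "nat \<Rightarrow> nat \<Rightarrow> nat" where
  "sref i = transpose i (i + 1)"

definition word_prod :: "nat list \<Rightarrow> nat \<Rightarrow> nat" where
  "word_prod a = foldr (\<lambda>i f. sref i \<circ> f) a id"

definition reduced_word :: "(nat \<Rightarrow> nat) \<Rightarrow> nat list \<Rightarrow> bool" where
  "reduced_word w a \<longleftrightarrow> (\<forall>i\<in>set a. 1 \<le> i) \<and> word_prod a = w \<and>
     (\<forall>b. (\<forall>i\<in>set b. 1 \<le> i) \<and> word_prod b = w \<longrightarrow> length a \<le> length b)"

definition cont :: "nat list \<Rightarrow> nat \<Rightarrow> nat" where
  "cont a j = count_list a j"

definition quasi_luk_perm :: "(nat \<Rightarrow> nat) \<Rightarrow> bool" where
  "quasi_luk_perm w \<longleftrightarrow> (\<forall>a. reduced_word w a \<longrightarrow> quasi_luk (cont a))"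

definition compress :: "nat \<Rightarrow> (nat \<Rightarrow>\<^sub>0 nat) \<Rightarrow> nat list" where
  "compress m \<mu> = filter (\<lambda>e. e \<noteq> 0) (map (Poly_Mapping.lookup \<mu>) [1..<m+1])"

definition quasisym :: "nat \<Rightarrow> 'k::comm_ring_1 kpoly \<Rightarrow> bool" where
  "quasisym m P \<longleftrightarrow> (\<forall>\<mu>\<in>Poly_Mapping.keys P. Poly_Mapping.keys \<mu> \<subseteq> {1..m}) \<and>
     (\<forall>\<mu> \<nu>. Poly_Mapping.keys \<mu> \<subseteq> {1..m} \<and> Poly_Mapping.keys \<nu> \<subseteq> {1..m} \<and> compress m \<mu> = compress m \<nu>
        \<longrightarrow> Poly_Mapping.lookup P \<mu> = Poly_Mapping.lookup P \<nu>)"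

definition pswap :: "nat \<Rightarrow> 'k::comm_ring_1 kpoly \<Rightarrow> 'k kpoly" where
  "pswap i = psubst (\<lambda>j. pvar (sref i j))"

definition divdiff :: "nat \<Rightarrow> 'k::comm_ring_1 kpoly \<Rightarrow> 'k kpoly" where
  "divdiff i f = (THE g. (pvar i - pvar (i + 1)) * g = f - pswap i f)"

definition longest :: "nat \<Rightarrow> nat \<Rightarrow> nat" where
  "longest n i = (if 1 \<le> i \<and> i \<le> n then n + 1 - i else i)"

inductive schub_rel :: "nat \<Rightarrow> (nat \<Rightarrow> nat) \<Rightarrow> 'k::comm_ring_1 kpoly \<Rightarrow> bool" for n where
  base: "schub_rel n (longest n) (\<Prod>i\<in>{1..<n}. pvar i ^ (n - i))"
| step: "schub_rel n w P \<Longrightarrow> 1 \<le> i \<Longrightarrow> i < n \<Longrightarrow> w i > w (i + 1) \<Longrightarrow>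
         schub_rel n (w \<circ> sref i) (divdiff i P)"

definition schubert :: "nat \<Rightarrow> (nat \<Rightarrow> nat) \<Rightarrow> 'k::comm_ring_1 kpoly" where
  "schubert n w = (THE P. schub_rel n w P)"

end

theory Submission
  imports Defs
begin

text \<open>
  Write \<open>x\<^sub>i = u\<^sub>i - u\<^sub>i\<^sub>-\<^sub>1\<close>. The relations of \<open>\<K>\<^sub>+\<close> say \<open>u\<^sub>i x\<^sub>i\<^sub>+\<^sub>1 = q u\<^sub>i x\<^sub>i\<close>: in the presence of \<open>u\<^sub>i\<close>,
  the variable \<open>x\<^sub>i\<^sub>+\<^sub>1\<close> may be replaced by \<open>q x\<^sub>i\<close>.

  (1) If \<open>a \<le> j \<le> b\<close>, then \<open>u\<^sub>j u\<^bsub>{a..b}\<^esub>\<close> is a combination of \<open>u\<^bsub>{a-1..b}\<^esub>\<close> and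
  \<open>u\<^bsub>{a..b+1}\<^esub>\<close>. Multiply the factors of \<open>z\<^sup>c\<close> from left to right: the product of the first factors
  is a combination of intervals of size \<open>c\<^sub>1 + \<dots> + c\<^sub>j\<close>, which by hypothesis reach up to \<open>j\<close>, so that
  the next factor is inside or adjacent to each of them.

  (2) A monomial quasisymmetric polynomial in \<open>x\<^sub>1, \<dots>, x\<^sub>m\<close> is an iterated sum over the largest index.
  The sequences in \<open>m\<close> spanned by \<open>x\<^sub>m\<^sub>+\<^sub>1\<^sup>s u\<^sub>m u\<^sub>m\<^sub>+\<^sub>1 \<dots> u\<^sub>m\<^sub>+\<^sub>b\<close> have the property for every \<open>m\<close> and are
  stable under multiplication by \<open>x\<^sub>m\<^sub>+\<^sub>1\<^sup>a\<close> (\<open>a \<ge> 1\<close>) followed by summation over \<open>m\<close>.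

  (3) \<open>\<SS>\<^sub>w\<close> evaluated at \<open>x\<close> is a combination of the \<open>u\<^bsub>a\<^esub>\<close> for reduced words \<open>a\<close> of \<open>w\<close>, to which
  (1) applies. For \<open>q \<noteq> 1\<close>, pass from \<open>\<SS>\<^sub>w(x)\<close> to \<open>\<SS>\<^sub>w(q x)\<close> one variable at a time; modulo the
  relations the \<open>i\<close>-th increment is \<open>(1 - q) u\<^sub>i\<close> times a value of \<open>\<partial>\<^sub>i \<SS>\<^sub>w\<close>, which is zero or the
  Schubert polynomial of a shorter permutation, and \<open>\<SS>\<^sub>w(x) - \<SS>\<^sub>w(q x) = (1 - q\<^sup>\<l>) \<SS>\<^sub>w(x)\<close> where
  \<open>\<l>\<close> is the length of \<open>w\<close>. For \<open>q = 1\<close> one has \<open>\<l> \<SS>\<^sub>w(x) = \<Sum>\<^sub>i u\<^sub>i (\<partial>\<^sub>i \<SS>\<^sub>w)(x)\<close> instead.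
\<close>

subsection \<open>Polynomials and substitution\<close>

lemma pconst_0 [simp]: "pconst 0 = 0"
  and pconst_1 [simp]: "pconst 1 = 1"
  and pconst_add: "pconst (a + b) = pconst a + pconst b"
  and pconst_mult: "pconst (a * b) = pconst a * pconst b"
  and pconst_uminus: "pconst (- a) = - pconst a"
  and pconst_diff: "pconst (a - b) = pconst a - pconst b"
  by (simp_all add: pconst_def single_add single_uminus single_diff mult_single)

lemma pconst_power: "pconst (a ^ n) = pconst a ^ n"
  by (induction n) (simp_all add: pconst_mult)

lemma pconst_of_nat: "pconst (of_nat n) = of_nat n"
  by (induction n) (simp_all add: pconst_add)

lemma pvar_power: "(pvar i :: 'k::comm_ring_1 kpoly) ^ n = Poly_Mapping.single (Poly_Mapping.single i n) 1"
  by (induction n) (simp_all add: pvar_def mult_single flip: single_add)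

lemma prod_single_one:
  "(\<Prod>i\<in>A. Poly_Mapping.single (g i :: nat \<Rightarrow>\<^sub>0 nat) (1::'k::comm_ring_1)) = Poly_Mapping.single (\<Sum>i\<in>A. g i) 1"
  by (induction A rule: infinite_finite_induct) (simp_all add: mult_single)

lemma monomial_sum_keys:
  fixes m :: "nat \<Rightarrow>\<^sub>0 nat"
  assumes "finite A" "Poly_Mapping.keys m \<subseteq> A"
  shows "(\<Sum>i\<in>A. Poly_Mapping.single i (Poly_Mapping.lookup m i)) = m"
proof (rule poly_mapping_eqI)
  fix k
  have "Poly_Mapping.lookup (\<Sum>i\<in>A. Poly_Mapping.single i (Poly_Mapping.lookup m i)) k
      = (\<Sum>i\<in>A. if i = k then Poly_Mapping.lookup m k else 0)"
    unfolding lookup_sum by (rule sum.cong) (auto simp: lookup_single when_def)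
  also have "\<dots> = Poly_Mapping.lookup m k"
    using assms by (auto simp: in_keys_iff)
  finally show "Poly_Mapping.lookup (\<Sum>i\<in>A. Poly_Mapping.single i (Poly_Mapping.lookup m i)) k
      = Poly_Mapping.lookup m k" .
qed

lemma single_eq_prod:
  fixes a :: "'k::comm_ring_1"
  assumes "finite A" "Poly_Mapping.keys m \<subseteq> A"
  shows "Poly_Mapping.single m a = pconst a * (\<Prod>i\<in>A. pvar i ^ Poly_Mapping.lookup m i)"
  by (simp add: pvar_power prod_single_one monomial_sum_keys[OF assms] pconst_def mult_single)

lemma kpoly_sum_singles:
  fixes p :: "'k::comm_ring_1 kpoly"
  shows "(\<Sum>m\<in>Poly_Mapping.keys p. Poly_Mapping.single m (Poly_Mapping.lookup p m)) = p"
proof (rule poly_mapping_eqI)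
  fix k
  have "Poly_Mapping.lookup (\<Sum>m\<in>Poly_Mapping.keys p. Poly_Mapping.single m (Poly_Mapping.lookup p m)) k
      = (\<Sum>i\<in>Poly_Mapping.keys p. if i = k then Poly_Mapping.lookup p k else 0)"
    unfolding lookup_sum by (rule sum.cong) (auto simp: lookup_single when_def)
  also have "\<dots> = Poly_Mapping.lookup p k"
    by (auto simp: in_keys_iff)
  finally show "Poly_Mapping.lookup (\<Sum>m\<in>Poly_Mapping.keys p. Poly_Mapping.single m (Poly_Mapping.lookup p m)) k
      = Poly_Mapping.lookup p k" .
qed

lemma kpoly_single_induct [case_names single add]:
  fixes p :: "'k::comm_ring_1 kpoly"
  assumes single: "\<And>m a. P (Poly_Mapping.single m a)" and add: "\<And>f g. P f \<Longrightarrow> P g \<Longrightarrow> P (f + g)"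
  shows "P p"
proof -
  have "P (\<Sum>m\<in>A. Poly_Mapping.single m (Poly_Mapping.lookup p m))" for A
  proof (induction A rule: infinite_finite_induct)
    case (infinite A)
    then show ?case using single[of 0 0] by simp
  next
    case empty
    then show ?case using single[of 0 0] by simp
  qed (simp add: single add)
  then show ?thesis by (metis kpoly_sum_singles)
qed

lemma kpoly_induct [case_names const var add mult]:
  fixes p :: "'k::comm_ring_1 kpoly"
  assumes const: "\<And>a. P (pconst a)" and var: "\<And>i. P (pvar i)"
    and add: "\<And>f g. P f \<Longrightarrow> P g \<Longrightarrow> P (f + g)" and mult: "\<And>f g. P f \<Longrightarrow> P g \<Longrightarrow> P (f * g)"
  shows "P p"
proof (induction p rule: kpoly_single_induct)
  case (single m a)
  have one: "P 1" using const[of 1] by simp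
  have pow: "P (pvar i ^ n)" for i n
    by (induction n) (simp_all add: one var mult)
  have "P (\<Prod>i\<in>A. pvar i ^ Poly_Mapping.lookup m i)" for A
    by (induction A rule: infinite_finite_induct) (simp_all add: one pow mult)
  then show ?case by (simp add: single_eq_prod[OF finite_keys order_refl] mult const)
qed (rule add)

definition mono_eval :: "(nat \<Rightarrow> 'k::comm_ring_1 kpoly) \<Rightarrow> (nat \<Rightarrow>\<^sub>0 nat) \<Rightarrow> 'k kpoly" where
  "mono_eval \<sigma> m = (\<Prod>i\<in>Poly_Mapping.keys m. \<sigma> i ^ Poly_Mapping.lookup m i)"

lemma mono_eval_superset:
  assumes "finite A" "Poly_Mapping.keys m \<subseteq> A"
  shows "mono_eval \<sigma> m = (\<Prod>i\<in>A. \<sigma> i ^ Poly_Mapping.lookup m i)"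
  unfolding mono_eval_def using assms by (intro prod.mono_neutral_left) (auto simp: in_keys_iff)

lemma mono_eval_add: "mono_eval \<sigma> (m + n) = mono_eval \<sigma> m * mono_eval \<sigma> n"
proof -
  let ?A = "Poly_Mapping.keys m \<union> Poly_Mapping.keys n"
  have "mono_eval \<sigma> (m + n) = (\<Prod>i\<in>?A. \<sigma> i ^ Poly_Mapping.lookup (m + n) i)"
    by (rule mono_eval_superset) (auto simp: Poly_Mapping.keys_add)
  also have "\<dots> = mono_eval \<sigma> m * mono_eval \<sigma> n"
    by (simp add: lookup_add power_add prod.distrib mono_eval_superset[of ?A])
  finally show ?thesis .
qed

lemma psubst_superset:
  assumes "finite A" "Poly_Mapping.keys p \<subseteq> A"
  shows "psubst \<sigma> p = (\<Sum>m\<in>A. pconst (Poly_Mapping.lookup p m) * mono_eval \<sigma> m)"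
  unfolding psubst_def mono_eval_def
  using assms by (intro sum.mono_neutral_left) (auto simp: in_keys_iff)

lemma psubst_0 [simp]: "psubst \<sigma> 0 = 0"
  by (simp add: psubst_def)

lemma psubst_single: "psubst \<sigma> (Poly_Mapping.single m a) = pconst a * mono_eval \<sigma> m"
  by (simp add: psubst_superset[of "{m}"])

lemma psubst_const [simp]: "psubst \<sigma> (pconst a) = pconst a"
  by (simp add: pconst_def psubst_single mono_eval_def)

lemma psubst_1 [simp]: "psubst \<sigma> 1 = 1"
  using psubst_const[of \<sigma> 1] by simp

lemma psubst_var [simp]: "psubst \<sigma> (pvar i) = \<sigma> i"
  by (simp add: pvar_def psubst_single mono_eval_def)

lemma psubst_add [simp]: "psubst \<sigma> (f + g) = psubst \<sigma> f + psubst \<sigma> g"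
  by (simp add: psubst_superset[of "Poly_Mapping.keys f \<union> Poly_Mapping.keys g"] Poly_Mapping.keys_add
      lookup_add pconst_add distrib_right sum.distrib)

lemma psubst_mult [simp]: "psubst \<sigma> (f * g) = psubst \<sigma> f * psubst \<sigma> g"
proof (induction f rule: kpoly_single_induct)
  case (single m a)
  show ?case
    by (induction g rule: kpoly_single_induct)
      (simp_all add: mult_single psubst_single mono_eval_add pconst_mult algebra_simps)
qed (simp add: distrib_right)

lemma psubst_uminus [simp]: "psubst \<sigma> (- f) = - psubst \<sigma> f"
  using psubst_mult[of \<sigma> "pconst (-1)" f] unfolding psubst_const by (simp add: pconst_uminus)

lemma psubst_diff [simp]: "psubst \<sigma> (f - g) = psubst \<sigma> f - psubst \<sigma> g"
  using psubst_add[of \<sigma> f "- g"] by simp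

lemma psubst_power [simp]: "psubst \<sigma> (f ^ n) = psubst \<sigma> f ^ n"
  by (induction n) simp_all

lemma psubst_prod [simp]: "psubst \<sigma> (\<Prod>i\<in>A. f i) = (\<Prod>i\<in>A. psubst \<sigma> (f i))"
  by (induction A rule: infinite_finite_induct) simp_all

lemma psubst_psubst: "psubst \<sigma> (psubst \<tau> f) = psubst (\<lambda>i. psubst \<sigma> (\<tau> i)) f"
  by (induction f rule: kpoly_induct) simp_all

subsection \<open>The ideal of relations and spans modulo it\<close>

text \<open>Free finite index sets let two elements of the ideal be written over one common set.
  Index 0 stays out because the relations start at 1.\<close>

lemma in_klideal_iff:
  "in_klideal q f \<longleftrightarrow> (\<exists>g A. finite A \<and> 0 \<notin> A \<and> f = (\<Sum>i\<in>A. g i * klrel q i))"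
proof
  assume "in_klideal q f"
  then show "\<exists>g A. finite A \<and> 0 \<notin> A \<and> f = (\<Sum>i\<in>A. g i * klrel q i)"
    unfolding in_klideal_def by (metis atLeastAtMost_iff finite_atLeastAtMost not_one_le_zero)
next
  assume "\<exists>g A. finite A \<and> 0 \<notin> A \<and> f = (\<Sum>i\<in>A. g i * klrel q i)"
  then obtain g A where A: "finite A" "0 \<notin> A" and f: "f = (\<Sum>i\<in>A. g i * klrel q i)" by blast
  have "A \<subseteq> {1..Max (insert 1 A)}"
    using A by (auto simp: Suc_le_eq intro: gr0I)
  then have "f = (\<Sum>i\<in>{1..Max (insert 1 A)}. (if i \<in> A then g i else 0) * klrel q i)"
    unfolding f by (intro sum.mono_neutral_cong_left) auto
  then show "in_klideal q f"
    unfolding in_klideal_def by (intro exI[of _ "\<lambda>i. if i \<in> A then g i else 0"] exI)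
qed

lemma in_klideal_0 [simp]: "in_klideal q 0"
  unfolding in_klideal_def by (rule exI[of _ "\<lambda>_. 0"]) simp

lemma in_klideal_add:
  assumes "in_klideal q f" "in_klideal q g"
  shows "in_klideal q (f + g)"
proof -
  obtain a A b B where A: "finite A" "0 \<notin> A" and f: "f = (\<Sum>i\<in>A. a i * klrel q i)"
    and B: "finite B" "0 \<notin> B" and g: "g = (\<Sum>i\<in>B. b i * klrel q i)"
    using assms unfolding in_klideal_iff by blast
  have "f = (\<Sum>i\<in>A\<union>B. (if i \<in> A then a i else 0) * klrel q i)"
    unfolding f using A B by (intro sum.mono_neutral_cong_left) auto
  moreover have "g = (\<Sum>i\<in>A\<union>B. (if i \<in> B then b i else 0) * klrel q i)"
    unfolding g using A B by (intro sum.mono_neutral_cong_left) auto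
  ultimately have "f + g = (\<Sum>i\<in>A\<union>B. ((if i \<in> A then a i else 0) + (if i \<in> B then b i else 0)) * klrel q i)"
    by (simp add: distrib_right sum.distrib)
  then show ?thesis
    unfolding in_klideal_iff using A B by (intro exI conjI) auto
qed

lemma in_klideal_mult: "in_klideal q f \<Longrightarrow> in_klideal q (h * f)"
proof -
  assume "in_klideal q f"
  then obtain a N where "f = (\<Sum>i\<in>{1..N}. a i * klrel q i)"
    unfolding in_klideal_def by blast
  then have "h * f = (\<Sum>i\<in>{1..N}. (h * a i) * klrel q i)"
    by (simp add: sum_distrib_left mult.assoc)
  then show ?thesis unfolding in_klideal_def by (intro exI[of _ "\<lambda>i. h * a i"] exI)
qed

lemma in_klideal_uminus: "in_klideal q f \<Longrightarrow> in_klideal q (- f)"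
  using in_klideal_mult[of q f "-1"] by simp

lemma in_klideal_diff: "in_klideal q f \<Longrightarrow> in_klideal q g \<Longrightarrow> in_klideal q (f - g)"
  using in_klideal_add[of q f "- g"] by (simp add: in_klideal_uminus)

lemma in_klideal_sum: "(\<And>i. i \<in> A \<Longrightarrow> in_klideal q (f i)) \<Longrightarrow> in_klideal q (\<Sum>i\<in>A. f i)"
  by (induction A rule: infinite_finite_induct) (auto intro: in_klideal_add)

lemma in_klideal_klrel: "i \<ge> 1 \<Longrightarrow> in_klideal q (klrel q i)"
  unfolding in_klideal_iff by (intro exI[of _ "\<lambda>_. 1"] exI[of _ "{i}"]) simp

text \<open>The value of \<open>delta_plus\<close> on the variable of index i. Because
  \<open>zv 0 = 0\<close>, the special case i = 1 is included, and truncated subtraction gives 0 at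
  index 0.\<close>

definition xv :: "nat \<Rightarrow> 'k::comm_ring_1 kpoly" where
  "xv i = zv i - zv (i - 1)"

lemma zv_0 [simp]: "zv 0 = 0"
  by (simp add: zv_def)

lemma xv_0 [simp]: "xv 0 = 0"
  by (simp add: xv_def)

lemma delta_plus_eq: "delta_plus = psubst xv"
proof -
  have "(\<lambda>i. if i = 0 then 0 else if i = 1 then zv 1 else zv i - zv (i - 1)) = (xv :: nat \<Rightarrow> 'a kpoly)"
    by (auto simp: xv_def fun_eq_iff)
  then show ?thesis by (simp add: delta_plus_def)
qed

lemma klrel_eq: "klrel q i = zv i * (pconst q * xv i - xv (i + 1))"
  by (simp add: klrel_def xv_def pconst_add power2_eq_square algebra_simps)

lemma in_klideal_x: "in_klideal q (zv i * (xv (Suc i) - pconst q * xv i))"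
proof (cases "i = 0")
  case False
  have "zv i * (xv (Suc i) - pconst q * xv i) = - klrel q i"
    by (simp add: klrel_eq algebra_simps)
  then show ?thesis using False by (simp add: in_klideal_klrel in_klideal_uminus)
qed simp

text \<open>The linear span of G together with the ideal, which enters through \<open>cong\<close>.
  In inductive form, linear arguments reduce to generators without coefficient functions.\<close>

inductive kspan :: "'k::comm_ring_1 \<Rightarrow> 'k kpoly set \<Rightarrow> 'k kpoly \<Rightarrow> bool" for q G where
  zero: "kspan q G 0"
| gen: "g \<in> G \<Longrightarrow> kspan q G g"
| add: "kspan q G f \<Longrightarrow> kspan q G g \<Longrightarrow> kspan q G (f + g)"
| scale: "kspan q G f \<Longrightarrow> kspan q G (pconst a * f)"
| cong: "kspan q G f \<Longrightarrow> in_klideal q (g - f) \<Longrightarrow> kspan q G g"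

lemma kspan_uminus: "kspan q G f \<Longrightarrow> kspan q G (- f)"
  using kspan.scale[of q G f "-1"] by (simp add: pconst_uminus)

lemma kspan_diff: "kspan q G f \<Longrightarrow> kspan q G g \<Longrightarrow> kspan q G (f - g)"
  using kspan.add[of q G f "- g"] by (simp add: kspan_uminus)

lemma kspan_sum: "(\<And>i. i \<in> A \<Longrightarrow> kspan q G (f i)) \<Longrightarrow> kspan q G (\<Sum>i\<in>A. f i)"
  by (induction A rule: infinite_finite_induct) (auto intro: kspan.intros)

lemma kspan_image:
  assumes "kspan q G f" "\<And>g. g \<in> G \<Longrightarrow> kspan q H (h * g)"
  shows "kspan q H (h * f)"
  using assms(1)
proof (induction rule: kspan.induct)
  case (scale f a)
  then show ?case using kspan.scale[of q H "h * f" a] by (simp add: algebra_simps)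
next
  case (cong f g)
  then show ?case
    by (metis in_klideal_mult kspan.cong right_diff_distrib)
qed (auto simp: distrib_left intro: kspan.intros assms)

lemma kspan_mono:
  assumes "kspan q G f" "\<And>g. g \<in> G \<Longrightarrow> kspan q H g"
  shows "kspan q H f"
  using kspan_image[of q G f H 1] assms by simp

lemma kspan_cancel_const:
  fixes q :: "'k::field"
  assumes "kspan q G (pconst a * f)" "a \<noteq> 0"
  shows "kspan q G f"
proof -
  have "pconst (inverse a) * (pconst a * f) = f"
    using assms(2) by (metis left_inverse mult.assoc mult_1 pconst_1 pconst_mult)
  then show ?thesis using kspan.scale[OF assms(1), of "inverse a"] by (simp only:)
qed

text \<open>Intervals start at 1 or later because \<open>zset\<close> multiplies bare variables and
  does not kill index 0. With b < a the interval is empty and the generator is 1.\<close>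

definition interval_gens :: "'k::comm_ring_1 kpoly set" where
  "interval_gens = {zset {a..b} |a b. 1 \<le> a}"

text \<open>The passage from spans back to coefficient functions: each closure rule of
  \<open>kspan\<close> is matched by an operation on finitely supported coefficients.\<close>

lemma weak_interval_if_kspan:
  assumes "kspan q interval_gens f"
  shows "weak_interval q f"
  using assms
proof (induction rule: kspan.induct)
  case zero
  show ?case unfolding weak_interval_def by (rule exI[of _ "\<lambda>_. 0"]) simp
next
  case (gen g)
  then obtain a b where g: "g = zset {a..b}" and "1 \<le> a" by (auto simp: interval_gens_def)
  then have "0 \<notin> {a..b}" by auto
  moreover have "{I. (if I = {a..b} then 1 else 0 :: 'a) \<noteq> 0} = {{a..b}}" by auto
  ultimately show ?case
    unfolding weak_interval_def g
    by (intro exI[of _ "\<lambda>I. if I = {a..b} then 1 else 0"]) (auto simp: is_interval_def)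
next
  case (add f g)
  then obtain a b where a: "finite {I. a I \<noteq> 0}" "\<And>I. a I \<noteq> 0 \<Longrightarrow> finite I \<and> 0 \<notin> I \<and> is_interval I"
     "in_klideal q (f - (\<Sum>I\<in>{I. a I \<noteq> 0}. pconst (a I) * zset I))"
   and b: "finite {I. b I \<noteq> 0}" "\<And>I. b I \<noteq> 0 \<Longrightarrow> finite I \<and> 0 \<notin> I \<and> is_interval I"
     "in_klideal q (g - (\<Sum>I\<in>{I. b I \<noteq> 0}. pconst (b I) * zset I))"
    unfolding weak_interval_def by blast
  let ?U = "{I. a I \<noteq> 0} \<union> {I. b I \<noteq> 0}"
  have sa: "(\<Sum>I\<in>{I. a I \<noteq> 0}. pconst (a I) * zset I) = (\<Sum>I\<in>?U. pconst (a I) * zset I)"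
    and sb: "(\<Sum>I\<in>{I. b I \<noteq> 0}. pconst (b I) * zset I) = (\<Sum>I\<in>?U. pconst (b I) * zset I)"
    and sc: "(\<Sum>I\<in>{I. a I + b I \<noteq> 0}. pconst (a I + b I) * zset I) = (\<Sum>I\<in>?U. pconst (a I + b I) * zset I)"
    using a(1) b(1) by (intro sum.mono_neutral_left; auto)+
  have "(f + g) - (\<Sum>I\<in>{I. a I + b I \<noteq> 0}. pconst (a I + b I) * zset I)
      = (f - (\<Sum>I\<in>{I. a I \<noteq> 0}. pconst (a I) * zset I)) + (g - (\<Sum>I\<in>{I. b I \<noteq> 0}. pconst (b I) * zset I))"
    unfolding sa sb sc by (simp add: pconst_add distrib_right sum.distrib)
  then have "in_klideal q ((f + g) - (\<Sum>I\<in>{I. a I + b I \<noteq> 0}. pconst (a I + b I) * zset I))"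
    using in_klideal_add[OF a(3) b(3)] by (simp only:)
  moreover have "finite {I. a I + b I \<noteq> 0}"
    by (rule finite_subset[of _ ?U]) (use a(1) b(1) in auto)
  moreover have "\<forall>I. a I + b I \<noteq> 0 \<longrightarrow> finite I \<and> 0 \<notin> I \<and> is_interval I"
    using a(2) b(2) by (metis add_0)
  ultimately show ?case
    unfolding weak_interval_def by (intro exI[of _ "\<lambda>I. a I + b I"]) simp
next
  case (scale f c)
  then obtain a where a: "finite {I. a I \<noteq> 0}" "\<And>I. a I \<noteq> 0 \<Longrightarrow> finite I \<and> 0 \<notin> I \<and> is_interval I"
     "in_klideal q (f - (\<Sum>I\<in>{I. a I \<noteq> 0}. pconst (a I) * zset I))"
    unfolding weak_interval_def by blast
  have s: "(\<Sum>I\<in>{I. c * a I \<noteq> 0}. pconst (c * a I) * zset I) = (\<Sum>I\<in>{I. a I \<noteq> 0}. pconst (c * a I) * zset I)"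
    by (rule sum.mono_neutral_left) (use a(1) in auto)
  have "pconst c * f - (\<Sum>I\<in>{I. c * a I \<noteq> 0}. pconst (c * a I) * zset I)
      = pconst c * (f - (\<Sum>I\<in>{I. a I \<noteq> 0}. pconst (a I) * zset I))"
    unfolding s by (simp add: right_diff_distrib sum_distrib_left pconst_mult mult.assoc)
  then have "in_klideal q (pconst c * f - (\<Sum>I\<in>{I. c * a I \<noteq> 0}. pconst (c * a I) * zset I))"
    using a(3) by (simp add: in_klideal_mult)
  moreover have "finite {I. c * a I \<noteq> 0}"
    by (rule finite_subset[OF _ a(1)]) auto
  moreover have "\<forall>I. c * a I \<noteq> 0 \<longrightarrow> finite I \<and> 0 \<notin> I \<and> is_interval I"
    using a(2) by (metis mult_zero_right)
  ultimately show ?case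
    unfolding weak_interval_def by (intro exI[of _ "\<lambda>I. c * a I"]) simp
next
  case (cong f g)
  then obtain a where a: "finite {I. a I \<noteq> 0}" "\<forall>I. a I \<noteq> 0 \<longrightarrow> finite I \<and> 0 \<notin> I \<and> is_interval I"
     "in_klideal q (f - (\<Sum>I\<in>{I. a I \<noteq> 0}. pconst (a I) * zset I))"
    unfolding weak_interval_def by blast
  have "in_klideal q (g - (\<Sum>I\<in>{I. a I \<noteq> 0}. pconst (a I) * zset I))"
    using in_klideal_add[OF a(3) cong.hyps(2)] by (simp add: algebra_simps)
  then show ?case unfolding weak_interval_def using a(1,2) by blast
qed

subsection \<open>Multiplying an interval by a variable\<close>

definition qint :: "'k::comm_ring_1 \<Rightarrow> nat \<Rightarrow> 'k" where
  "qint q n = (\<Sum>i<n. q ^ i)"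

lemma qint_0 [simp]: "qint q 0 = 0"
  and qint_Suc: "qint q (Suc n) = qint q n + q ^ n"
  by (simp_all add: qint_def)

text \<open>For q = 1 the value is n, nonzero in characteristic zero; otherwise (1 - q) times it is
  1 - q^n, nonzero by the hypothesis on q. The later divisions by q-integers rest on this.\<close>

lemma qint_nonzero:
  fixes q :: "'k::field_char_0"
  assumes "\<forall>n::nat. n > 0 \<longrightarrow> q ^ n = 1 \<longrightarrow> q = 1" "n > 0"
  shows "qint q n \<noteq> 0"
proof (cases "q = 1")
  case True
  then show ?thesis using assms(2) by (simp add: qint_def)
next
  case False
  have "1 - q ^ n = (1 - q) * qint q n"
    unfolding qint_def by (rule one_diff_power_eq)
  then show ?thesis using assms False by auto
qed

lemma zset_atLeastAtMost: "1 \<le> a \<Longrightarrow> zset {a..b} = (\<Prod>i\<in>{a..b}. zv i)"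
  unfolding zset_def by (rule prod.cong) (auto simp: zv_def)

lemma in_klideal_prod_x:
  assumes "finite A" "i \<in> A"
  shows "in_klideal q ((\<Prod>k\<in>A. zv k) * (xv (Suc i) - pconst q * xv i))"
proof -
  have "(\<Prod>k\<in>A. zv k) * (xv (Suc i) - pconst q * xv i)
      = (\<Prod>k\<in>A - {i}. zv k) * (zv i * (xv (Suc i) - pconst q * xv i))"
    using assms by (simp add: prod.remove[of A i] mult.assoc mult.left_commute)
  then show ?thesis by (simp add: in_klideal_mult in_klideal_x)
qed

text \<open>The replacement of \<open>xv (Suc i)\<close> by q times \<open>xv i\<close> is iterated
  over i = a, ..., a + k - 1, since each such \<open>zv i\<close> is a factor of the product. The
  bound on k lets the chain end at \<open>xv (Suc b)\<close>.\<close>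

lemma in_klideal_interval_x:
  assumes "k \<le> Suc b - a" "a \<le> b"
  shows "in_klideal q ((\<Prod>i\<in>{a..b}. zv i) * (xv (a + k) - pconst (q ^ k) * xv a))"
  using assms(1)
proof (induction k)
  case (Suc k)
  let ?U = "\<Prod>i\<in>{a..b}. zv i :: 'a kpoly"
  have "in_klideal q (?U * (xv (Suc (a + k)) - pconst q * xv (a + k)))"
    using Suc.prems by (intro in_klideal_prod_x) auto
  moreover have "in_klideal q (pconst q * (?U * (xv (a + k) - pconst (q ^ k) * xv a)))"
    using Suc by (intro in_klideal_mult[of q "?U * _"]) simp
  ultimately have "in_klideal q (?U * (xv (Suc (a + k)) - pconst q * xv (a + k))
      + pconst q * (?U * (xv (a + k) - pconst (q ^ k) * xv a)))"
    by (rule in_klideal_add)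
  then show ?case by (simp add: algebra_simps pconst_mult)
qed simp

text \<open>Telescoping: the increments from \<open>zv (a - 1)\<close> on are \<open>xv a\<close>,
  \<open>xv (a + 1)\<close>, ..., a geometric progression by the previous lemma, and k of them add
  up to a q-integer times \<open>xv a\<close>.\<close>

lemma in_klideal_interval_z:
  assumes "k \<le> Suc (Suc b) - a" "1 \<le> a" "a \<le> b"
  shows "in_klideal q ((\<Prod>i\<in>{a..b}. zv i) * (zv (a + k - 1) - zv (a - 1) - pconst (qint q k) * xv a))"
  using assms(1)
proof (induction k)
  case (Suc k)
  let ?U = "\<Prod>i\<in>{a..b}. zv i :: 'a kpoly"
  have z: "zv (a + Suc k - 1) = zv (a + k - 1) + xv (a + k)"
    using assms by (simp add: xv_def)
  have "in_klideal q (?U * (xv (a + k) - pconst (q ^ k) * xv a))"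
    using Suc.prems assms(3) by (intro in_klideal_interval_x) auto
  moreover have "in_klideal q (?U * (zv (a + k - 1) - zv (a - 1) - pconst (qint q k) * xv a))"
    using Suc by simp
  ultimately have "in_klideal q (?U * (xv (a + k) - pconst (q ^ k) * xv a)
     + ?U * (zv (a + k - 1) - zv (a - 1) - pconst (qint q k) * xv a))"
    by (rule in_klideal_add)
  then show ?case unfolding z qint_Suc pconst_add by (simp add: algebra_simps)
qed simp

text \<open>Modulo the relations, \<open>u\<^sub>a\<^sub>-\<^sub>1, u\<^sub>a, \<dots>, u\<^sub>b\<^sub>+\<^sub>1\<close> times \<open>u\<^bsub>{a..b}\<^esub>\<close> have increments in
  geometric progression, so all of them interpolate between the two outer ones.\<close>

lemma kspan_zv_interval:
  fixes q :: "'k::field_char_0"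
  assumes q: "\<forall>n::nat. n > 0 \<longrightarrow> q ^ n = 1 \<longrightarrow> q = 1"
    and "1 \<le> a" "a \<le> j" "j \<le> b"
  shows "kspan q (zset ` {I. I = {a..Suc b} \<or> (2 \<le> a \<and> I = {a-1..b})}) (zv j * zset {a..b})"
proof -
  let ?U = "\<Prod>i\<in>{a..b}. zv i :: 'k kpoly"
  let ?G = "zset ` {I. I = {a..Suc b} \<or> (2 \<le> a \<and> I = {a-1..b})} :: 'k kpoly set"
  \<comment> \<open>The number of increments between \<open>zv (a - 1)\<close> and
    \<open>zv (Suc b)\<close>. Both ends give generators (or 0 at the lower end when a = 1), so
    dividing their difference by \<open>qint q k\<close> puts \<open>?U * xv a\<close> into the
    span.\<close>
  define k where "k = Suc (Suc b) - a"
  have lo: "kspan q ?G (?U * zv (a - 1))"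
  proof (cases "a = 1")
    case False
    then have "{a-1..b} = insert (a - 1) {a..b}" using assms by auto
    then have "zset {a-1..b} = ?U * zv (a - 1)"
      using False assms by (subst zset_atLeastAtMost) (auto simp: mult.commute)
    moreover have "zset {a-1..b} \<in> ?G"
      by (rule imageI) (use False assms in simp)
    ultimately show ?thesis using kspan.gen[of "zset {a-1..b}" ?G q] by (simp only:)
  qed (simp add: kspan.zero)
  have "{a..Suc b} = insert (Suc b) {a..b}" using assms by auto
  then have "zset {a..Suc b} = ?U * zv (Suc b)"
    using assms by (subst zset_atLeastAtMost) (auto simp: mult.commute)
  moreover have "zset {a..Suc b} \<in> ?G"
    by (rule imageI) simp
  ultimately have hi: "kspan q ?G (?U * zv (Suc b))"
    using kspan.gen[of "zset {a..Suc b}" ?G q] by (simp only:)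
  have "in_klideal q (?U * (zv (Suc b) - zv (a - 1) - pconst (qint q k) * xv a))"
    using in_klideal_interval_z[of k b a q] assms unfolding k_def by (simp add: Suc_diff_le)
  moreover have "?U * (pconst (qint q k) * xv a) - (?U * zv (Suc b) - ?U * zv (a - 1))
       = - (?U * (zv (Suc b) - zv (a - 1) - pconst (qint q k) * xv a))"
    by (simp add: algebra_simps)
  ultimately have "kspan q ?G (?U * (pconst (qint q k) * xv a))"
    using kspan.cong[OF kspan_diff[OF hi lo], of "?U * (pconst (qint q k) * xv a)"] by (simp only: in_klideal_uminus)
  then have "kspan q ?G (pconst (qint q k) * (?U * xv a))"
    by (simp only: mult.left_commute)
  moreover have "qint q k \<noteq> 0"
    using qint_nonzero[OF q, of k] assms by (simp add: k_def)
  ultimately have x: "kspan q ?G (?U * xv a)"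
    by (rule kspan_cancel_const)
  define l where "l = Suc j - a"
  have "in_klideal q (?U * (zv j - zv (a - 1) - pconst (qint q l) * xv a))"
    using in_klideal_interval_z[of l b a q] assms unfolding l_def by (simp add: Suc_diff_le)
  moreover have "?U * zv j - (?U * zv (a - 1) + pconst (qint q l) * (?U * xv a))
      = ?U * (zv j - zv (a - 1) - pconst (qint q l) * xv a)"
    by (simp add: algebra_simps)
  ultimately have "kspan q ?G (?U * zv j)"
    using kspan.cong[OF kspan.add[OF lo kspan.scale[OF x, of "qint q l"]], of "?U * zv j"] by (simp only:)
  then show ?thesis
    using assms by (simp add: zset_atLeastAtMost mult.commute)
qed

subsection \<open>Quasi-Lukasiewicz monomials\<close>

text \<open>The invariant of the left-to-right multiplication: intervals with N elements that start
  at j or before and reach h.\<close>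

definition interval_gens_at :: "nat \<Rightarrow> nat \<Rightarrow> nat \<Rightarrow> 'k::comm_ring_1 kpoly set" where
  "interval_gens_at j N h = {zset {a..b} |a b. 1 \<le> a \<and> a \<le> j \<and> h \<le> b \<and> Suc b = a + N}"

lemma interval_gens_atI:
  "1 \<le> a \<Longrightarrow> a \<le> j \<Longrightarrow> h \<le> b \<Longrightarrow> Suc b = a + N \<Longrightarrow> zset {a..b} \<in> interval_gens_at j N h"
  unfolding interval_gens_at_def by blast

text \<open>If i lies inside the interval, interpolation extends it by one at either end; if i is
  the next index after its end, it is appended. In both cases the size grows by one and the end
  reaches both h and i.\<close>

lemma kspan_interval_gens_at_zv:
  fixes q :: "'k::field_char_0"
  assumes q: "\<forall>n::nat. n > 0 \<longrightarrow> q ^ n = 1 \<longrightarrow> q = 1"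
    and f: "kspan q (interval_gens_at j N h) f" and "j \<le> i" "i \<le> Suc h" "i \<le> h'" "h' \<le> max h i"
  shows "kspan q (interval_gens_at j (Suc N) h') (zv i * f)"
proof (rule kspan_image[OF f])
  fix g :: "'k kpoly"
  assume "g \<in> interval_gens_at j N h"
  then obtain a b where g: "g = zset {a..b}" and ab: "1 \<le> a" "a \<le> j" "h \<le> b" "Suc b = a + N"
    by (auto simp: interval_gens_at_def)
  show "kspan q (interval_gens_at j (Suc N) h') (zv i * g)"
  proof (cases "i \<le> b")
    case True
    have "kspan q (zset ` {I. I = {a..Suc b} \<or> (2 \<le> a \<and> I = {a-1..b})}) (zv i * g)"
      unfolding g using True ab assms by (intro kspan_zv_interval) auto
    then show ?thesis
    proof (rule kspan_mono)
      fix y :: "'k kpoly"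
      assume "y \<in> zset ` {I. I = {a..Suc b} \<or> (2 \<le> a \<and> I = {a-1..b})}"
      then consider "y = zset {a..Suc b}" | "2 \<le> a" "y = zset {a-1..b}" by auto
      then have "y \<in> interval_gens_at j (Suc N) h'"
      proof cases
        case 1
        show ?thesis unfolding 1 by (rule interval_gens_atI) (use ab True assms in auto)
      next
        case 2
        show ?thesis unfolding 2 by (rule interval_gens_atI) (use 2 ab True assms in auto)
      qed
      then show "kspan q (interval_gens_at j (Suc N) h') y" by (rule kspan.gen)
    qed
  next
    case False
    then have i: "i = Suc b" using assms ab by auto
    have "{a..Suc b} = insert (Suc b) {a..b}" using False i assms ab by auto
    then have "zv i * g = zset {a..Suc b}"
      unfolding g i zset_def by (simp add: zv_def)
    moreover have "zset {a..Suc b} \<in> interval_gens_at j (Suc N) h'"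
      by (rule interval_gens_atI) (use ab i assms in auto)
    ultimately show ?thesis
      using kspan.gen[of "zset {a..Suc b}" "interval_gens_at j (Suc N) h'" q] by (simp only:)
  qed
qed

lemma kspan_interval_gens_at_zv_power:
  fixes q :: "'k::field_char_0"
  assumes q: "\<forall>n::nat. n > 0 \<longrightarrow> q ^ n = 1 \<longrightarrow> q = 1"
    and f: "kspan q (interval_gens_at j N h) f" and "j \<le> i" "i \<le> h"
  shows "kspan q (interval_gens_at j (N + n) h) (zv i ^ n * f)"
proof (induction n)
  case (Suc n)
  then show ?case
    using kspan_interval_gens_at_zv[OF q Suc, of i h] assms by (simp add: mult.assoc)
qed (use f in simp)

lemma quasi_luk_interval_span:
  fixes q :: "'k::field_char_0"
  assumes q: "\<forall>n::nat. n > 0 \<longrightarrow> q ^ n = 1 \<longrightarrow> q = 1" and c: "quasi_luk c"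
  shows "kspan q interval_gens (\<Prod>i\<in>{j. c j \<noteq> 0}. zv i ^ c i)"
proof -
  define m where "m = (LEAST j. 1 \<le> j \<and> c j > 0 \<and> c (j + 1) = 0)"
  define M where "M = Max {j. c j > 0}"
  define j0 where "j0 = (LEAST j. c j > 0)"
  define F :: "nat \<Rightarrow> 'k kpoly" where "F j = (\<Prod>i\<in>{1..j}. zv i ^ c i)" for j
  define N where "N j = (\<Sum>i\<in>{1..j}. c i)" for j
  have c0: "c 0 = 0" and fin: "finite {j. c j > 0}" and ex: "\<exists>j. c j > 0"
    and luk: "\<And>j. m \<le> j \<Longrightarrow> j \<le> M \<Longrightarrow> N j \<ge> j"
    using c unfolding quasi_luk_def m_def M_def N_def Let_def by auto
  have j0: "c j0 > 0" and j0_le: "\<And>j. c j > 0 \<Longrightarrow> j0 \<le> j"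
    unfolding j0_def using LeastI_ex[OF ex] by (auto intro: Least_le)
  have "j0 \<ge> 1" using j0 c0 by (cases j0) auto
  have leM: "j \<le> M" if "c j > 0" for j
    unfolding M_def using fin that by (intro Max_ge) auto
  have FS: "F (Suc j) = zv (Suc j) ^ c (Suc j) * F j" and NS: "N (Suc j) = N j + c (Suc j)" for j
    by (simp_all add: F_def N_def mult.commute)
  have low: "F j = 1 \<and> N j = 0" if "j < j0" for j
  proof -
    have "c i = 0" if "i \<in> {1..j}" for i using j0_le[of i] that \<open>j < j0\<close> by fastforce
    then show ?thesis unfolding F_def N_def by auto
  qed
  \<comment> \<open>The factors of index up to j give intervals of size \<open>N j\<close> that
    start no later than \<open>j0\<close>, the least index of the support, and reach j. Hence the
    next factor lies inside or directly after each of them.\<close>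
  have main: "kspan q (interval_gens_at j0 (N j) j) (F j)" if "j0 \<le> j" "j \<le> M" for j
    using that
  proof (induction j rule: dec_induct)
    case base
    obtain j1 where j1: "j0 = Suc j1" using \<open>j0 \<ge> 1\<close> by (cases j0) auto
    obtain e where e: "c j0 = Suc e" using j0 by (cases "c j0") auto
    have "zset {j0..j0} \<in> interval_gens_at j0 1 j0"
      by (rule interval_gens_atI) (use \<open>j0 \<ge> 1\<close> in auto)
    then have "kspan q (interval_gens_at j0 1 j0) (zv j0)"
      using \<open>j0 \<ge> 1\<close> by (intro kspan.gen) (simp add: zset_def zv_def)
    then have "kspan q (interval_gens_at j0 (1 + e) j0) (zv j0 ^ e * zv j0)"
      using q by (intro kspan_interval_gens_at_zv_power) auto
    moreover have "F j0 = zv j0 ^ e * zv j0" "N j0 = 1 + e"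
      using FS[of j1] NS[of j1] low[of j1] j1 e by (auto simp: mult.commute)
    ultimately show ?case by simp
  next
    case (step j)
    then have IH: "kspan q (interval_gens_at j0 (N j) j) (F j)" by simp
    show ?case
    proof (cases "c (Suc j)")
      case 0
      then have "F (Suc j) = F j" "N (Suc j) = N j" by (simp_all add: FS NS)
      \<comment> \<open>Between \<open>j0\<close>, where c is positive, and \<open>Suc j\<close>,
        where it vanishes, some positive entry is followed by a zero. This bounds m by i, so the
        quasi-Lukasiewicz inequality is available at \<open>Suc j\<close>.\<close>
      obtain i where i: "j0 \<le> i" "i \<le> j" "c i > 0" "c (Suc i) = 0"
      proof -
        have "\<exists>i. j0 \<le> i \<and> i \<le> j \<and> c i > 0 \<and> c (Suc i) = 0"
        proof (rule ccontr)
          assume neg: "\<not> ?thesis"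
          have "j0 \<le> i \<Longrightarrow> i \<le> Suc j \<Longrightarrow> c i > 0" for i
          proof (induction i rule: dec_induct)
            case base
            then show ?case using j0 by simp
          next
            case (step i)
            then show ?case using neg by auto
          qed
          from this[of "Suc j"] show False using 0 step by simp
        qed
        then show ?thesis using that by blast
      qed
      have "m \<le> i" unfolding m_def using i \<open>j0 \<ge> 1\<close> by (intro Least_le) auto
      then have "N (Suc j) \<ge> Suc j" using i step by (intro luk) auto
      \<comment> \<open>An interval with at least \<open>Suc j\<close> elements that starts at 1 or
        later ends at \<open>Suc j\<close> or later, so the reach improves although nothing is
        multiplied.\<close>
      then have "interval_gens_at j0 (N j) j \<subseteq> (interval_gens_at j0 (N (Suc j)) (Suc j) :: 'k kpoly set)"
        unfolding \<open>N (Suc j) = N j\<close> interval_gens_at_def by fastforce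
      then show ?thesis
        using kspan_mono[OF IH] \<open>F (Suc j) = F j\<close> by (metis kspan.gen subsetD)
    next
      case (Suc e)
      have "kspan q (interval_gens_at j0 (Suc (N j)) (Suc j)) (zv (Suc j) * F j)"
        using step by (intro kspan_interval_gens_at_zv[OF q IH]) auto
      then have "kspan q (interval_gens_at j0 (Suc (N j) + e) (Suc j)) (zv (Suc j) ^ e * (zv (Suc j) * F j))"
        using step by (intro kspan_interval_gens_at_zv_power[OF q]) auto
      then show ?thesis unfolding FS NS Suc by (simp add: mult.assoc mult.commute mult.left_commute)
    qed
  qed
  have pos: "Suc 0 \<le> i" if "c i > 0" for i
    using that c0 by (cases i) auto
  have "F M = (\<Prod>i\<in>{j. c j \<noteq> 0}. zv i ^ c i)"
    unfolding F_def using leM pos by (intro prod.mono_neutral_right) auto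
  moreover have "kspan q interval_gens (F M)"
    by (rule kspan_mono[OF main[OF leM[OF j0] order_refl] kspan.gen]) (auto simp: interval_gens_def interval_gens_at_def)
  ultimately show ?thesis by simp
qed

lemma kspan_quasi_luk_single:
  fixes q :: "'k::field_char_0"
  assumes q: "\<forall>n::nat. n > 0 \<longrightarrow> q ^ n = 1 \<longrightarrow> q = 1" and c: "quasi_luk (Poly_Mapping.lookup c)"
  shows "kspan q interval_gens (Poly_Mapping.single c 1)"
proof -
  have "0 \<notin> Poly_Mapping.keys c"
    using c by (simp add: quasi_luk_def in_keys_iff)
  then have "Poly_Mapping.single c (1::'k) = (\<Prod>i\<in>Poly_Mapping.keys c. zv i ^ Poly_Mapping.lookup c i)"
    unfolding single_eq_prod[OF finite_keys order_refl] zv_def by (auto intro!: prod.cong)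
  then show ?thesis
    using quasi_luk_interval_span[OF q c] by (simp add: keys.rep_eq)
qed

subsection \<open>Quasisymmetric polynomials\<close>

lemma in_klideal_power_diff:
  assumes "in_klideal q (d * (y - y'))"
  shows "in_klideal q (d * (y ^ n - y' ^ n))"
proof (induction n)
  case (Suc n)
  have "d * (y ^ Suc n - y' ^ Suc n) = y * (d * (y ^ n - y' ^ n)) + y' ^ n * (d * (y - y'))"
    by (simp add: algebra_simps)
  then show ?case using Suc assms by (simp add: in_klideal_add in_klideal_mult)
qed simp

section \<open>Rising products and their sums\<close>

definition zrise :: "nat \<Rightarrow> nat \<Rightarrow> 'k::comm_ring_1 kpoly" where
  "zrise b m = (\<Prod>i<b. zv (m + i))"

lemma zrise_0 [simp]: "zrise 0 m = 1"
  and zrise_Suc: "zrise (Suc b) m = zrise b m * zv (m + b)"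
  by (simp_all add: zrise_def)

lemma zrise_Suc_left: "zrise (Suc b) m = zv m * zrise b (Suc m)"
  unfolding zrise_def by (subst prod.lessThan_Suc_shift) simp

lemma zrise_eq_prod: "b \<ge> 1 \<Longrightarrow> zrise b m = (\<Prod>i\<in>{m..m + b - 1}. zv i)"
  unfolding zrise_def
  by (rule prod.reindex_bij_witness[of _ "\<lambda>i. i - m" "\<lambda>i. m + i"]) auto

lemma in_klideal_zrise_x:
  "in_klideal q (zrise (Suc b) m * (xv (Suc m) ^ s - pconst (q ^ s) * xv m ^ s))"
proof -
  have "in_klideal q (zrise b (Suc m) * (zv m * (xv (Suc m) - pconst q * xv m)))"
    by (intro in_klideal_mult in_klideal_x)
  then have "in_klideal q (zrise (Suc b) m * (xv (Suc m) - pconst q * xv m))"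
    by (simp only: zrise_Suc_left mult.assoc mult.left_commute)
  then have "in_klideal q (zrise (Suc b) m * (xv (Suc m) ^ s - (pconst q * xv m) ^ s))"
    by (rule in_klideal_power_diff)
  then show ?thesis by (simp only: power_mult_distrib pconst_power)
qed

lemma in_klideal_zrise_z:
  assumes "1 \<le> m"
  shows "in_klideal q (zrise b m * (zv (m + b) - zv (m - 1) - pconst (qint q (Suc b)) * xv m))"
proof (cases "b = 0")
  case True
  then show ?thesis by (simp add: qint_Suc xv_def)
next
  case False
  then show ?thesis
    using in_klideal_interval_z[of "Suc b" "m + b - 1" m q] assms by (simp add: zrise_eq_prod)
qed

text \<open>Whole sequences are spanned, up to termwise congruence, with coefficients independent of
  m; this uniformity is what allows summation over m.\<close>

inductive qseq :: "'k::comm_ring_1 \<Rightarrow> (nat \<Rightarrow> 'k kpoly) \<Rightarrow> bool" for q where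
  gen: "qseq q (\<lambda>m. xv (Suc m) ^ s * zrise (Suc b) m)"
| add: "qseq q A \<Longrightarrow> qseq q B \<Longrightarrow> qseq q (\<lambda>m. A m + B m)"
| scale: "qseq q A \<Longrightarrow> qseq q (\<lambda>m. pconst a * A m)"
| cong: "qseq q A \<Longrightarrow> (\<And>m. in_klideal q (B m - A m)) \<Longrightarrow> qseq q B"

lemma qseq_diff: "qseq q A \<Longrightarrow> qseq q B \<Longrightarrow> qseq q (\<lambda>m. A m - B m)"
  using qseq.add[of q A "\<lambda>m. pconst (- 1) * B m"] qseq.scale[of q B "- 1"]
  by (simp add: pconst_uminus)

lemma qseq_cancel_const:
  fixes q :: "'k::field"
  assumes "qseq q (\<lambda>m. pconst a * A m)" "a \<noteq> 0"
  shows "qseq q A"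
proof -
  have "pconst (inverse a) * (pconst a * A m) = A m" for m
    using assms(2) by (metis left_inverse mult.assoc mult_1 pconst_1 pconst_mult)
  then show ?thesis using qseq.scale[OF assms(1), of "inverse a"] by (simp only:)
qed

definition zrise_sum :: "nat \<Rightarrow> nat \<Rightarrow> nat \<Rightarrow> 'k::comm_ring_1 kpoly" where
  "zrise_sum s b m = (\<Sum>j\<in>{1..m}. xv j ^ s * zrise b j)"

text \<open>Discrete integration by parts: the summand is the increment of
  \<open>m \<mapsto> xv (m + 1)\<^sup>s * zrise (b + 1) m\<close>.\<close>

lemma in_klideal_zrise_sum:
  "in_klideal q ((pconst (q ^ s) - 1) * zrise_sum s (Suc b) m + pconst (qint q (Suc b)) * zrise_sum (Suc s) b m
     - xv (Suc m) ^ s * zrise (Suc b) m)"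
proof (induction m)
  case 0
  show ?case by (simp add: zrise_sum_def zrise_Suc_left)
next
  case (Suc m)
  let ?Q = "pconst (q ^ s)" and ?c = "pconst (qint q (Suc b))" and ?x = "xv (Suc m) :: 'a kpoly"
  let ?D = "zrise b (Suc m) * (zv (Suc m + b) - zv m - ?c * ?x)"
  let ?R = "zrise (Suc b) (Suc m) * (xv (Suc (Suc m)) ^ s - ?Q * ?x ^ s)"
  have D: "in_klideal q ?D"
    using in_klideal_zrise_z[of "Suc m" q b] by simp
  have R: "in_klideal q ?R" by (rule in_klideal_zrise_x)
  \<comment> \<open>\<open>?R\<close> trades \<open>xv (Suc (Suc m)) ^ s\<close> for q^s times
    \<open>?x ^ s\<close>, and \<open>?D\<close> trades the difference of the two outer variables
    for a q-integer times \<open>?x\<close>.\<close>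
  have eq: "(?Q - 1) * zrise_sum s (Suc b) (Suc m) + ?c * zrise_sum (Suc s) b (Suc m)
      - xv (Suc (Suc m)) ^ s * zrise (Suc b) (Suc m)
    = ((?Q - 1) * zrise_sum s (Suc b) m + ?c * zrise_sum (Suc s) b m - ?x ^ s * zrise (Suc b) m)
      - ?R - ?x ^ s * ?D"
    unfolding zrise_Suc_left[of b m] zrise_Suc[of b "Suc m"] by (simp add: zrise_sum_def zrise_Suc algebra_simps)
  show ?case
    unfolding eq by (intro in_klideal_diff Suc R in_klideal_mult D)
qed

text \<open>Integration by parts is solved for the sum with the higher exponent, whose coefficient
  is a nonzero q-integer. The other sum has a lower exponent but a longer product, hence the
  induction on s with b arbitrary; at exponent 0 its coefficient q^0 - 1 vanishes.\<close>

lemma qseq_zrise_sum: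
  fixes q :: "'k::field_char_0"
  assumes q: "\<forall>n::nat. n > 0 \<longrightarrow> q ^ n = 1 \<longrightarrow> q = 1"
  shows "qseq q (zrise_sum (Suc s) b)"
proof (induction s arbitrary: b)
  case 0
  have "qseq q (\<lambda>m. pconst (qint q (Suc b)) * zrise_sum (Suc 0) b m)"
    by (rule qseq.cong[OF qseq.gen[of q 0 b]]) (use in_klideal_zrise_sum[of q 0 b] in simp)
  then show ?case by (rule qseq_cancel_const) (simp add: qint_nonzero[OF q])
next
  case (Suc s)
  have "qseq q (\<lambda>m. xv (Suc m) ^ Suc s * zrise (Suc b) m
      - pconst (q ^ Suc s - 1) * zrise_sum (Suc s) (Suc b) m)"
    by (intro qseq_diff qseq.gen qseq.scale Suc)
  moreover have "in_klideal q (pconst (qint q (Suc b)) * zrise_sum (Suc (Suc s)) b m -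
      (xv (Suc m) ^ Suc s * zrise (Suc b) m - pconst (q ^ Suc s - 1) * zrise_sum (Suc s) (Suc b) m))" for m
    using in_klideal_zrise_sum[of q "Suc s" b m] by (simp add: algebra_simps pconst_diff)
  ultimately have "qseq q (\<lambda>m. pconst (qint q (Suc b)) * zrise_sum (Suc (Suc s)) b m)"
    by (rule qseq.cong)
  then show ?case by (rule qseq_cancel_const) (simp add: qint_nonzero[OF q])
qed

lemma qseq_sum:
  fixes q :: "'k::field_char_0"
  assumes q: "\<forall>n::nat. n > 0 \<longrightarrow> q ^ n = 1 \<longrightarrow> q = 1" and A: "qseq q A"
  shows "qseq q (\<lambda>m. \<Sum>j\<in>{1..m}. xv j ^ Suc a * A (j - 1))"
  using A
proof (induction rule: qseq.induct)
  case (gen s b)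
  \<comment> \<open>On a generator the summand contains \<open>zv (j - 1)\<close>, which next to
    \<open>zrise b j\<close> may be replaced by \<open>zv (j + b)\<close> minus a q-integer times
    \<open>xv j\<close>. The two resulting sums were just treated.\<close>
  have "qseq q (\<lambda>m. zrise_sum (Suc (s + a)) (Suc b) m
      - pconst (qint q (Suc b)) * zrise_sum (Suc (Suc (s + a))) b m)"
    by (intro qseq_diff qseq.scale qseq_zrise_sum[OF q])
  then show ?case
  proof (rule qseq.cong)
    fix m
    let ?D = "\<lambda>j. zrise b j * (zv (j + b) - zv (j - 1) - pconst (qint q (Suc b)) * xv j)"
    have "(\<Sum>j\<in>{1..m}. xv j ^ Suc a * (xv (Suc (j - 1)) ^ s * zrise (Suc b) (j - 1)))
       - (zrise_sum (Suc (s + a)) (Suc b) m - pconst (qint q (Suc b)) * zrise_sum (Suc (Suc (s + a))) b m)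
       = (\<Sum>j\<in>{1..m}. - (xv j ^ Suc (s + a)) * ?D j)"
      unfolding zrise_sum_def sum_distrib_left sum_subtractf[symmetric]
    proof (rule sum.cong)
      fix j assume "j \<in> {1..m}"
      then obtain j' where j: "j = Suc j'" by (cases j) auto
      show "xv j ^ Suc a * (xv (Suc (j - 1)) ^ s * zrise (Suc b) (j - 1)) -
          (xv j ^ Suc (s + a) * zrise (Suc b) j - pconst (qint q (Suc b)) * (xv j ^ Suc (Suc (s + a)) * zrise b j))
        = - (xv j ^ Suc (s + a)) * ?D j"
        unfolding j diff_Suc_1 zrise_Suc_left[of b j'] zrise_Suc[of b "Suc j'"]
        by (simp add: power_add algebra_simps)
    qed simp
    moreover have "in_klideal q (\<Sum>j\<in>{1..m}. - (xv j ^ Suc (s + a)) * ?D j)"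
      by (intro in_klideal_sum in_klideal_mult in_klideal_zrise_z) simp
    ultimately show "in_klideal q ((\<Sum>j\<in>{1..m}. xv j ^ Suc a * (xv (Suc (j - 1)) ^ s * zrise (Suc b) (j - 1)))
       - (zrise_sum (Suc (s + a)) (Suc b) m - pconst (qint q (Suc b)) * zrise_sum (Suc (Suc (s + a))) b m))"
      by (simp only:)
  qed
next
  case (add A B)
  then show ?case
    using qseq.add[OF add.IH] by (simp add: distrib_left sum.distrib)
next
  case (scale A c)
  then show ?case
    using qseq.scale[OF scale.IH, of c] by (simp add: sum_distrib_left mult.left_commute)
next
  case (cong A B)
  show ?case
  proof (rule qseq.cong[OF cong.IH])
    fix m
    have "(\<Sum>j\<in>{1..m}. xv j ^ Suc a * B (j - 1)) - (\<Sum>j\<in>{1..m}. xv j ^ Suc a * A (j - 1))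
        = (\<Sum>j\<in>{1..m}. xv j ^ Suc a * (B (j - 1) - A (j - 1)))"
      by (simp add: right_diff_distrib sum_subtractf)
    then show "in_klideal q ((\<Sum>j\<in>{1..m}. xv j ^ Suc a * B (j - 1)) - (\<Sum>j\<in>{1..m}. xv j ^ Suc a * A (j - 1)))"
      using cong.hyps(2) by (simp only: in_klideal_sum in_klideal_mult)
  qed
qed

text \<open>The product \<open>zrise (Suc b) m\<close> is an interval monomial, and each factor
  \<open>xv (Suc m)\<close> is \<open>zv (Suc m) - zv m\<close>. Both indices lie inside or directly
  after every interval that starts at m or before and reaches m.\<close>

lemma kspan_qseq:
  fixes q :: "'k::field_char_0"
  assumes q: "\<forall>n::nat. n > 0 \<longrightarrow> q ^ n = 1 \<longrightarrow> q = 1" and A: "qseq q A" and m: "1 \<le> m"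
  shows "kspan q interval_gens (A m)"
  using A
proof (induction rule: qseq.induct)
  case (gen s b)
  have "kspan q (interval_gens_at m (Suc b + s) m) (xv (Suc m) ^ s * zrise (Suc b) m)"
  proof (induction s)
    case 0
    have "zset {m..m + b} \<in> interval_gens_at m (Suc b) m"
      by (rule interval_gens_atI) (use m in auto)
    then have "kspan q (interval_gens_at m (Suc b) m) (zset {m..m + b})" by (rule kspan.gen)
    then show ?case using m by (simp add: zrise_eq_prod zset_atLeastAtMost)
  next
    case (Suc s)
    let ?f = "xv (Suc m) ^ s * zrise (Suc b) m :: 'k kpoly"
    have "kspan q (interval_gens_at m (Suc (Suc b + s)) m) (zv m * ?f)"
      by (rule kspan_interval_gens_at_zv[OF q Suc]) auto
    moreover have "kspan q (interval_gens_at m (Suc (Suc b + s)) (Suc m)) (zv (Suc m) * ?f)"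
      by (rule kspan_interval_gens_at_zv[OF q Suc]) auto
    then have "kspan q (interval_gens_at m (Suc (Suc b + s)) m) (zv (Suc m) * ?f)"
      by (rule kspan_mono[OF _ kspan.gen]) (auto simp: interval_gens_at_def dest: Suc_leD)
    ultimately have "kspan q (interval_gens_at m (Suc (Suc b + s)) m) (zv (Suc m) * ?f - zv m * ?f)"
      by (rule kspan_diff[rotated])
    then show ?case by (simp add: xv_def algebra_simps)
  qed
  then show ?case
    by (rule kspan_mono[OF _ kspan.gen]) (auto simp: interval_gens_at_def interval_gens_def)
qed (auto intro: kspan.intros)

text \<open>The monomial quasisymmetric polynomial in \<open>m\<close> variables, evaluated at \<open>xv\<close>; the composition is
  listed from its last part.\<close>

fun mqsym :: "nat list \<Rightarrow> nat \<Rightarrow> 'k::comm_ring_1 kpoly" where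
  "mqsym [] m = 1"
| "mqsym (a # as) m = (\<Sum>j\<in>{1..m}. xv j ^ a * mqsym as (j - 1))"

lemma qseq_mqsym:
  fixes q :: "'k::field_char_0"
  assumes q: "\<forall>n::nat. n > 0 \<longrightarrow> q ^ n = 1 \<longrightarrow> q = 1"
  shows "as \<noteq> [] \<Longrightarrow> 0 \<notin> set as \<Longrightarrow> qseq q (mqsym as)"
proof (induction as)
  case (Cons a as)
  then obtain a' where a: "a = Suc a'" by (cases a) auto
  show ?case
  proof (cases "as = []")
    case True
    have "mqsym (a # as) = (zrise_sum (Suc a') 0 :: nat \<Rightarrow> 'k kpoly)"
      by (simp add: True a zrise_sum_def fun_eq_iff)
    then show ?thesis using qseq_zrise_sum[OF q, of a' 0] by simp
  next
    case False
    then have "qseq q (\<lambda>m. \<Sum>j\<in>{1..m}. xv j ^ Suc a' * mqsym as (j - 1))"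
      using Cons by (intro qseq_sum[OF q]) simp
    moreover have "mqsym (a # as) = (\<lambda>m. \<Sum>j\<in>{1..m}. xv j ^ Suc a' * mqsym as (j - 1) :: 'k kpoly)"
      by (simp add: a fun_eq_iff)
    ultimately show ?thesis by (simp only:)
  qed
qed simp

section \<open>Monomials with a given composition\<close>

definition comp_monos :: "nat \<Rightarrow> nat list \<Rightarrow> (nat \<Rightarrow>\<^sub>0 nat) set" where
  "comp_monos m \<beta> = {\<mu>. Poly_Mapping.keys \<mu> \<subseteq> {1..m} \<and> compress m \<mu> = \<beta>}"

lemma compress_Suc:
  "compress (Suc m) \<mu> = compress m \<mu> @ (if Poly_Mapping.lookup \<mu> (Suc m) = 0 then [] else [Poly_Mapping.lookup \<mu> (Suc m)])"
  by (simp add: compress_def)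

lemma compress_add_single:
  "compress m (\<nu> + Poly_Mapping.single (Suc m) a) = compress m \<nu>"
proof -
  have "map (Poly_Mapping.lookup (\<nu> + Poly_Mapping.single (Suc m) a)) [1..<m + 1] = map (Poly_Mapping.lookup \<nu>) [1..<m + 1]"
    by (auto simp: lookup_add lookup_single)
  then show ?thesis by (simp only: compress_def)
qed

lemma keys_subset_Suc:
  assumes "Poly_Mapping.keys \<mu> \<subseteq> {1..Suc m}" "Poly_Mapping.lookup \<mu> (Suc m) = 0"
  shows "Poly_Mapping.keys \<mu> \<subseteq> {1..m}"
proof
  fix j assume j: "j \<in> Poly_Mapping.keys \<mu>"
  then have "j \<noteq> Suc m" using assms(2) by (metis in_keys_iff)
  then show "j \<in> {1..m}" using j assms(1) by fastforce
qed

lemma comp_monos_Suc_Nil: "comp_monos (Suc m) [] = comp_monos m []"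
proof -
  have "Poly_Mapping.keys \<mu> \<subseteq> {1..Suc m} \<and> Poly_Mapping.lookup \<mu> (Suc m) = 0 \<longleftrightarrow> Poly_Mapping.keys \<mu> \<subseteq> {1..m}" for \<mu> :: "nat \<Rightarrow>\<^sub>0 nat"
  proof
    assume "Poly_Mapping.keys \<mu> \<subseteq> {1..m}"
    moreover from this have "Suc m \<notin> Poly_Mapping.keys \<mu>" by auto
    ultimately show "Poly_Mapping.keys \<mu> \<subseteq> {1..Suc m} \<and> Poly_Mapping.lookup \<mu> (Suc m) = 0"
      by (auto simp: in_keys_iff)
  qed (blast intro: keys_subset_Suc[THEN subsetD])
  then show ?thesis unfolding comp_monos_def compress_Suc by auto
qed

text \<open>The variable of index \<open>Suc m\<close> either is absent or carries the last part a
  as its exponent. This split is the recursion behind \<open>mqsym\<close>.\<close>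

lemma comp_monos_Suc_snoc:
  assumes "a > 0"
  shows "comp_monos (Suc m) (\<gamma> @ [a]) =
    comp_monos m (\<gamma> @ [a]) \<union> (\<lambda>\<nu>. \<nu> + Poly_Mapping.single (Suc m) a) ` comp_monos m \<gamma>"
proof (intro equalityI subsetI)
  fix \<mu> assume \<mu>: "\<mu> \<in> comp_monos (Suc m) (\<gamma> @ [a])"
  show "\<mu> \<in> comp_monos m (\<gamma> @ [a]) \<union> (\<lambda>\<nu>. \<nu> + Poly_Mapping.single (Suc m) a) ` comp_monos m \<gamma>"
  proof (cases "Poly_Mapping.lookup \<mu> (Suc m) = 0")
    case True
    then have "Poly_Mapping.keys \<mu> \<subseteq> {1..m}"
      by (rule keys_subset_Suc[rotated]) (use \<mu> in \<open>simp add: comp_monos_def\<close>)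
    then show ?thesis using \<mu> True by (simp add: comp_monos_def compress_Suc)
  next
    case False
    define \<nu> where "\<nu> = \<mu> - Poly_Mapping.single (Suc m) a"
    have a: "Poly_Mapping.lookup \<mu> (Suc m) = a" and c: "compress m \<mu> = \<gamma>"
      using \<mu> False by (auto simp: comp_monos_def compress_Suc)
    have \<nu>: "\<mu> = \<nu> + Poly_Mapping.single (Suc m) a"
      by (rule poly_mapping_eqI) (auto simp: \<nu>_def lookup_add lookup_minus lookup_single when_def a)
    have "Poly_Mapping.lookup \<nu> (Suc m) = 0"
      by (simp add: \<nu>_def lookup_minus a)
    moreover have "Poly_Mapping.keys \<nu> \<subseteq> {1..Suc m}"
      using \<mu> by (auto simp: comp_monos_def in_keys_iff subset_iff \<nu>_def lookup_minus)
    ultimately have "Poly_Mapping.keys \<nu> \<subseteq> {1..m}"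
      by (rule keys_subset_Suc[rotated])
    moreover have "compress m \<nu> = \<gamma>"
      using c unfolding \<nu> compress_add_single .
    ultimately show ?thesis using \<nu> by (auto simp: comp_monos_def)
  qed
next
  fix \<mu> assume "\<mu> \<in> comp_monos m (\<gamma> @ [a]) \<union> (\<lambda>\<nu>. \<nu> + Poly_Mapping.single (Suc m) a) ` comp_monos m \<gamma>"
  then show "\<mu> \<in> comp_monos (Suc m) (\<gamma> @ [a])"
  proof
    assume \<mu>: "\<mu> \<in> comp_monos m (\<gamma> @ [a])"
    then have "Suc m \<notin> Poly_Mapping.keys \<mu>" by (auto simp: comp_monos_def)
    then show ?thesis using \<mu> by (auto simp: comp_monos_def compress_Suc in_keys_iff)
  next
    assume "\<mu> \<in> (\<lambda>\<nu>. \<nu> + Poly_Mapping.single (Suc m) a) ` comp_monos m \<gamma>"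
    then obtain \<nu> where \<mu>: "\<mu> = \<nu> + Poly_Mapping.single (Suc m) a" and \<nu>: "\<nu> \<in> comp_monos m \<gamma>" by blast
    have "Suc m \<notin> Poly_Mapping.keys \<nu>" using \<nu> by (auto simp: comp_monos_def)
    then have "Poly_Mapping.lookup \<mu> (Suc m) = a" by (simp add: \<mu> lookup_add in_keys_iff)
    moreover have "Poly_Mapping.keys \<mu> \<subseteq> {1..Suc m}"
    proof -
      have "Poly_Mapping.keys \<mu> \<subseteq> insert (Suc m) (Poly_Mapping.keys \<nu>)"
        using Poly_Mapping.keys_add[of \<nu> "Poly_Mapping.single (Suc m) a"] assms by (simp add: \<mu>)
      also have "\<dots> \<subseteq> {1..Suc m}" using \<nu> by (auto simp: comp_monos_def)
      finally show ?thesis .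
    qed
    ultimately show ?thesis
      using \<nu> assms by (simp add: comp_monos_def compress_Suc) (simp add: \<mu> compress_add_single)
  qed
qed

lemma sum_comp_monos:
  "0 \<notin> set \<beta> \<Longrightarrow> finite (comp_monos m \<beta>) \<and> (\<Sum>\<mu>\<in>comp_monos m \<beta>. mono_eval xv \<mu>) = mqsym (rev \<beta>) m"
proof (induction m arbitrary: \<beta>)
  case 0
  have "comp_monos 0 \<beta> = (if \<beta> = [] then {0} else {})"
    by (auto simp: comp_monos_def compress_def)
  then show ?case by (cases \<beta> rule: rev_cases) (auto simp: mono_eval_def)
next
  case (Suc m)
  show ?case
  proof (cases \<beta> rule: rev_cases)
    case Nil
    then show ?thesis using Suc.IH[of "[]"] by (simp add: comp_monos_Suc_Nil)
  next
    case (snoc \<gamma> a)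
    let ?h = "\<lambda>\<nu>. \<nu> + Poly_Mapping.single (Suc m) a"
    have a: "a > 0" and "0 \<notin> set \<gamma>" "0 \<notin> set (\<gamma> @ [a])" using Suc.prems snoc by auto
    note IH\<beta> = Suc.IH[OF this(3)] and IH\<gamma> = Suc.IH[OF this(2)]
    have inj: "inj_on ?h (comp_monos m \<gamma>)" by (auto intro: inj_onI)
    have disj: "comp_monos m (\<gamma> @ [a]) \<inter> ?h ` comp_monos m \<gamma> = {}"
    proof -
      have "Suc m \<in> Poly_Mapping.keys (?h \<nu>)" for \<nu>
        using a by (simp add: in_keys_iff lookup_add)
      then show ?thesis unfolding comp_monos_def by fastforce
    qed
    have "(\<Sum>\<mu>\<in>comp_monos (Suc m) \<beta>. mono_eval xv \<mu>)
      = mqsym (rev \<beta>) m + (\<Sum>\<nu>\<in>comp_monos m \<gamma>. mono_eval xv (?h \<nu>) :: 'a kpoly)"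
      unfolding snoc comp_monos_Suc_snoc[OF a] using IH\<beta> IH\<gamma> disj
      by (subst sum.union_disjoint) (auto simp: sum.reindex[OF inj])
    also have "(\<Sum>\<nu>\<in>comp_monos m \<gamma>. mono_eval xv (?h \<nu>) :: 'a kpoly) = xv (Suc m) ^ a * mqsym (rev \<gamma>) m"
    proof -
      have "mono_eval xv (Poly_Mapping.single (Suc m) a) = (xv (Suc m) ^ a :: 'a kpoly)"
        by (simp add: mono_eval_superset[of "{Suc m}"])
      then show ?thesis
        using IH\<gamma> by (simp add: mono_eval_add sum_distrib_right[symmetric] mult.commute)
    qed
    finally show ?thesis
      using IH\<beta> IH\<gamma> by (simp add: snoc comp_monos_Suc_snoc[OF a])
  qed
qed

text \<open>Grouping the monomials by composition writes P as a combination of monomial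
  quasisymmetric polynomials.\<close>

lemma kspan_quasisym:
  fixes q :: "'k::field_char_0"
  assumes q: "\<forall>n::nat. n > 0 \<longrightarrow> q ^ n = 1 \<longrightarrow> q = 1" and m: "1 \<le> m" and P: "quasisym m P"
  shows "kspan q interval_gens (delta_plus P)"
proof -
  let ?K = "Poly_Mapping.keys P"
  let ?c = "\<lambda>\<mu>. pconst (Poly_Mapping.lookup P \<mu>) * mono_eval xv \<mu> :: 'k kpoly"
  have "delta_plus P = (\<Sum>\<mu>\<in>?K. ?c \<mu>)"
    by (simp add: delta_plus_eq psubst_superset[OF finite_keys order_refl])
  also have "\<dots> = (\<Sum>\<beta>\<in>compress m ` ?K. \<Sum>\<mu>\<in>{\<mu> \<in> ?K. compress m \<mu> = \<beta>}. ?c \<mu>)"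
    by (rule sum.image_gen) simp
  also have "kspan q interval_gens \<dots>"
  proof (rule kspan_sum)
    fix \<beta> assume "\<beta> \<in> compress m ` ?K"
    then obtain \<mu>0 where \<mu>0: "\<mu>0 \<in> ?K" "\<beta> = compress m \<mu>0" by blast
    have sub: "\<And>\<mu>. \<mu> \<in> ?K \<Longrightarrow> Poly_Mapping.keys \<mu> \<subseteq> {1..m}"
      using P unfolding quasisym_def by blast
    have eq: "Poly_Mapping.lookup P \<mu> = Poly_Mapping.lookup P \<mu>0"
      if "Poly_Mapping.keys \<mu> \<subseteq> {1..m}" "compress m \<mu> = \<beta>" for \<mu>
    proof -
      have "\<forall>\<mu> \<nu>. Poly_Mapping.keys \<mu> \<subseteq> {1..m} \<and> Poly_Mapping.keys \<nu> \<subseteq> {1..m} \<and> compress m \<mu> = compress m \<nu>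
          \<longrightarrow> Poly_Mapping.lookup P \<mu> = Poly_Mapping.lookup P \<nu>"
        using P unfolding quasisym_def by (rule conjunct2)
      from this[rule_format, of \<mu> \<mu>0] show ?thesis using that sub[OF \<mu>0(1)] \<mu>0(2) by simp
    qed
    \<comment> \<open>Coefficients are constant on a composition, so as soon as one of its monomials
      occurs in P, all of them do.\<close>
    have set: "{\<mu> \<in> ?K. compress m \<mu> = \<beta>} = comp_monos m \<beta>"
    proof (intro set_eqI iffI)
      fix \<mu> assume "\<mu> \<in> comp_monos m \<beta>"
      then have c: "Poly_Mapping.keys \<mu> \<subseteq> {1..m}" "compress m \<mu> = \<beta>"
        by (simp_all add: comp_monos_def)
      then show "\<mu> \<in> {\<mu> \<in> ?K. compress m \<mu> = \<beta>}"
        using \<mu>0(1) eq[OF c] by (simp add: in_keys_iff)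
    qed (use sub in \<open>auto simp: comp_monos_def\<close>)
    have "0 \<notin> set \<beta>" by (auto simp: \<mu>0 compress_def)
    then have s: "(\<Sum>\<mu>\<in>comp_monos m \<beta>. mono_eval xv \<mu>) = (mqsym (rev \<beta>) m :: 'k kpoly)"
      using sum_comp_monos by blast
    have "(\<Sum>\<mu>\<in>{\<mu> \<in> ?K. compress m \<mu> = \<beta>}. ?c \<mu>) = (\<Sum>\<mu>\<in>comp_monos m \<beta>. pconst (Poly_Mapping.lookup P \<mu>0) * mono_eval xv \<mu>)"
      unfolding set by (rule sum.cong) (auto simp: comp_monos_def eq)
    also have "\<dots> = pconst (Poly_Mapping.lookup P \<mu>0) * mqsym (rev \<beta>) m"
      using s by (simp add: sum_distrib_left[symmetric])
    also have "kspan q interval_gens \<dots>"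
    \<comment> \<open>The empty composition gives the constant 1, the generator of the empty
      interval; the other compositions are covered by \<open>qseq\<close>.\<close>
    proof (rule kspan.scale, cases "\<beta> = []")
      case True
      have "zset {1..0} \<in> (interval_gens :: 'k kpoly set)"
        unfolding interval_gens_def by blast
      then show "kspan q interval_gens (mqsym (rev \<beta>) m)"
        using True kspan.gen[of "zset {1..0}" interval_gens q] by (simp add: zset_def)
    next
      case False
      then show "kspan q interval_gens (mqsym (rev \<beta>) m)"
        using \<open>0 \<notin> set \<beta>\<close> by (intro kspan_qseq[OF q _ m] qseq_mqsym[OF q]) auto
    qed
    finally show "kspan q interval_gens (\<Sum>\<mu>\<in>{\<mu> \<in> ?K. compress m \<mu> = \<beta>}. ?c \<mu>)" .
  qed
  finally show ?thesis .
qed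

subsection \<open>Divided differences\<close>

lemma sref_simps [simp]: "sref i i = Suc i" "sref i (Suc i) = i"
  and sref_other: "j \<noteq> i \<Longrightarrow> j \<noteq> Suc i \<Longrightarrow> sref i j = j"
  by (simp_all add: sref_def transpose_def)

lemma sref_sref [simp]: "sref i (sref i j) = j"
  by (simp add: sref_def)

lemma pswap_simps [simp]:
  "pswap i (pconst a) = pconst a" "pswap i (pvar j) = pvar (sref i j)" "pswap i 0 = 0" "pswap i 1 = 1"
  "pswap i (f + g) = pswap i f + pswap i g" "pswap i (f * g) = pswap i f * pswap i g"
  "pswap i (f - g) = pswap i f - pswap i g" "pswap i (- f) = - pswap i f"
  "pswap i (f ^ n) = pswap i f ^ n" "pswap i (prod h A) = (\<Prod>k\<in>A. pswap i (h k))"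
  by (simp_all add: pswap_def)

lemma psubst_pswap: "psubst \<sigma> (pswap i f) = psubst (\<sigma> \<circ> sref i) f"
  by (simp add: pswap_def psubst_psubst o_def)

lemma psubst_pvar [simp]: "psubst pvar f = f"
  by (induction f rule: kpoly_induct) simp_all

lemma pswap_pswap [simp]: "pswap i (pswap i f) = f"
  by (simp add: pswap_def psubst_psubst)

lemma pswap_commute:
  assumes "Suc i < j"
  shows "pswap i (pswap j f) = pswap j (pswap i f)"
proof -
  have "sref i (sref j k) = sref j (sref i k)" for k
    using assms by (simp add: sref_def transpose_def)
  then show ?thesis by (simp add: pswap_def psubst_psubst)
qed

lemma pswap_braid: "pswap i (pswap (Suc i) (pswap i f)) = pswap (Suc i) (pswap i (pswap (Suc i) f))"
proof -
  have "sref i (sref (Suc i) (sref i k)) = sref (Suc i) (sref i (sref (Suc i) k))" for k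
    by (simp add: sref_def transpose_def)
  then show ?thesis by (simp add: pswap_def psubst_psubst)
qed

lemma pvar_diff_nonzero:
  assumes "i \<noteq> j"
  shows "pvar i - pvar j \<noteq> (0 :: 'k::comm_ring_1 kpoly)"
proof
  assume "pvar i - pvar j = (0 :: 'k kpoly)"
  then have "Poly_Mapping.keys (pvar i :: 'k kpoly) = Poly_Mapping.keys (pvar j :: 'k kpoly)" by simp
  then have "Poly_Mapping.single i (1::nat) = Poly_Mapping.single j 1"
    by (simp add: pvar_def)
  then have "Poly_Mapping.keys (Poly_Mapping.single i (1::nat)) = Poly_Mapping.keys (Poly_Mapping.single j (1::nat))"
    by (simp only:)
  then show False using assms by simp
qed

text \<open>The quotient is explicit on constants and variables, and the twisted Leibniz rule builds
  it for products.\<close>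

lemma divdiff_exists: "\<exists>g. (pvar i - pvar (Suc i)) * g = f - pswap i f"
proof (induction f rule: kpoly_induct)
  case (const a)
  show ?case by (rule exI[of _ 0]) simp
next
  case (var j)
  consider "j = i" | "j = Suc i" | "j \<noteq> i" "j \<noteq> Suc i" by blast
  then show ?case
  proof cases
    case 1
    show ?thesis by (rule exI[of _ 1]) (simp add: 1)
  next
    case 2
    show ?thesis by (rule exI[of _ "-1"]) (simp add: 2)
  next
    case 3
    show ?thesis by (rule exI[of _ 0]) (simp add: 3 sref_other)
  qed
next
  case (add f g)
  then obtain f' g' where "(pvar i - pvar (Suc i)) * f' = f - pswap i f" "(pvar i - pvar (Suc i)) * g' = g - pswap i g"
    by blast
  then have "(pvar i - pvar (Suc i)) * (f' + g') = (f + g) - pswap i (f + g)"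
    by (simp add: distrib_left)
  then show ?case by blast
next
  case (mult f g)
  then obtain f' g' where "(pvar i - pvar (Suc i)) * f' = f - pswap i f" "(pvar i - pvar (Suc i)) * g' = g - pswap i g"
    by blast
  then have "((pvar i - pvar (Suc i)) * f') * g + pswap i f * ((pvar i - pvar (Suc i)) * g') = f * g - pswap i (f * g)"
    by (simp only: pswap_simps) (simp add: algebra_simps)
  then have "(pvar i - pvar (Suc i)) * (f' * g + pswap i f * g') = f * g - pswap i (f * g)"
    by (simp add: algebra_simps)
  then show ?case by blast
qed

lemma divdiff_cancel:
  fixes g h :: "'k::idom kpoly"
  shows "(pvar i - pvar (Suc i)) * g = (pvar i - pvar (Suc i)) * h \<Longrightarrow> g = h"
  using pvar_diff_nonzero[of i "Suc i"] by (metis mult_left_cancel n_not_Suc_n)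

lemma divdiff_unique:
  fixes f :: "'k::idom kpoly"
  assumes "(pvar i - pvar (Suc i)) * g = f - pswap i f"
  shows "divdiff i f = g"
  unfolding divdiff_def Suc_eq_plus1[symmetric] using assms
  by (intro the_equality) (simp, metis divdiff_cancel)

lemma divdiff_eq:
  fixes f :: "'k::idom kpoly"
  shows "(pvar i - pvar (Suc i)) * divdiff i f = f - pswap i f"
  using divdiff_exists[of i f] divdiff_unique by metis

lemma divdiff_const [simp]: "divdiff i (pconst (a::'k::idom)) = 0"
  by (rule divdiff_unique) simp

lemma divdiff_0 [simp]: "divdiff i (0::'k::idom kpoly) = 0"
  by (rule divdiff_unique) simp

lemma divdiff_var:
  "divdiff i (pvar j :: 'k::idom kpoly) = (if j = i then 1 else 0) - (if j = Suc i then 1 else 0)"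
  by (rule divdiff_unique) (simp add: sref_other)

lemma divdiff_add:
  fixes f g :: "'k::idom kpoly"
  shows "divdiff i (f + g) = divdiff i f + divdiff i g"
  by (rule divdiff_unique) (simp add: distrib_left divdiff_eq)

lemma divdiff_mult:
  fixes f g :: "'k::idom kpoly"
  shows "divdiff i (f * g) = divdiff i f * g + pswap i f * divdiff i g"
proof (rule divdiff_unique)
  have "(pvar i - pvar (Suc i)) * (divdiff i f * g + pswap i f * divdiff i g)
      = ((pvar i - pvar (Suc i)) * divdiff i f) * g + pswap i f * ((pvar i - pvar (Suc i)) * divdiff i g)"
    by (simp add: algebra_simps)
  then show "(pvar i - pvar (Suc i)) * (divdiff i f * g + pswap i f * divdiff i g) = f * g - pswap i (f * g)"
    unfolding divdiff_eq by (simp add: algebra_simps)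
qed

lemma pswap_divdiff:
  fixes f :: "'k::idom kpoly"
  shows "pswap i (divdiff i f) = divdiff i f"
proof (rule divdiff_cancel)
  have "pswap i ((pvar i - pvar (Suc i)) * divdiff i f) = pswap i f - f"
    by (simp only: divdiff_eq pswap_simps pswap_pswap)
  then have "(pvar (Suc i) - pvar i) * pswap i (divdiff i f) = - (f - pswap i f)"
    by simp
  then have "(pvar (Suc i) - pvar i) * pswap i (divdiff i f) = - ((pvar i - pvar (Suc i)) * divdiff i f)"
    unfolding divdiff_eq .
  then show "(pvar i - pvar (Suc i)) * pswap i (divdiff i f) = (pvar i - pvar (Suc i)) * divdiff i f"
    by (simp add: algebra_simps)
qed

lemma divdiff_symmetric:
  fixes f :: "'k::idom kpoly"
  shows "pswap i f = f \<Longrightarrow> divdiff i f = 0"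
  by (rule divdiff_unique) simp

lemma divdiff_divdiff:
  fixes f :: "'k::idom kpoly"
  shows "divdiff i (divdiff i f) = 0"
  by (rule divdiff_symmetric) (rule pswap_divdiff)

lemma divdiff_pswap:
  fixes f :: "'k::idom kpoly"
  shows "divdiff i (pswap i f) = - divdiff i f"
  by (rule divdiff_unique) (simp add: divdiff_eq)

section \<open>Commutation and braid relations\<close>

lemma divdiff_commute:
  fixes f :: "'k::idom kpoly"
  assumes "Suc i < j"
  shows "divdiff i (divdiff j f) = divdiff j (divdiff i f)"
proof -
  let ?A = "pvar i - pvar (Suc i) :: 'k kpoly" and ?B = "pvar j - pvar (Suc j) :: 'k kpoly"
  have sB: "pswap i ?B = ?B" and sA: "pswap j ?A = ?A"
    using assms by (simp_all add: sref_other)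
  have "?B * pswap i (divdiff j f) = pswap i (?B * divdiff j f)"
    by (simp only: pswap_simps(6) sB)
  then have 1: "?B * pswap i (divdiff j f) = pswap i f - pswap i (pswap j f)"
    by (simp only: divdiff_eq pswap_simps)
  have "?A * pswap j (divdiff i f) = pswap j (?A * divdiff i f)"
    by (simp only: pswap_simps(6) sA)
  then have 2: "?A * pswap j (divdiff i f) = pswap j f - pswap j (pswap i f)"
    by (simp only: divdiff_eq pswap_simps)
  have "?A * (?B * divdiff i (divdiff j f)) = ?B * (?A * divdiff i (divdiff j f))"
    by (simp only: mult.left_commute)
  also have "\<dots> = f - pswap j f - (pswap i f - pswap i (pswap j f))"
    unfolding divdiff_eq[of i] right_diff_distrib 1 by (simp only: divdiff_eq)
  also have "\<dots> = f - pswap i f - (pswap j f - pswap j (pswap i f))"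
    by (simp add: pswap_commute[OF assms])
  also have "\<dots> = ?A * (?B * divdiff j (divdiff i f))"
    unfolding divdiff_eq[of j] right_diff_distrib 2 by (simp only: divdiff_eq)
  finally show ?thesis by (blast dest: divdiff_cancel)
qed

text \<open>The ring-theoretic part of the braid relation: three divided differences times the
  denominators A, B and A + B become an alternating sum over the symmetric group on three letters.
  Names such as \<open>tsf\<close> stand for images of f under the swaps s and t.\<close>

lemma braid_expansion:
  fixes A B :: "'a::comm_ring_1"
  assumes "A * g = f - sf" "B * h = g - tg" "A * k = h - sh" "(A + B) * tg = tf - tsf"
    "(A + B) * sh = g - stg" "B * stg = stf - stsf"
  shows "A * (B * ((A + B) * k)) = f - sf - tf + tsf + stf - stsf"
proof -
  have "A * (B * ((A + B) * k)) = (A + B) * (B * (A * k))"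
    by (simp add: algebra_simps)
  also have "\<dots> = (A + B) * (B * h) - B * ((A + B) * sh)"
    unfolding assms(3) by (simp add: algebra_simps)
  also have "\<dots> = A * g - (A + B) * tg + B * stg"
    unfolding assms(2,5) by (simp add: algebra_simps)
  also have "\<dots> = f - sf - tf + tsf + stf - stsf"
    unfolding assms by (simp add: algebra_simps)
  finally show ?thesis .
qed

text \<open>Both sides lead to the same alternating sum, because the swaps satisfy the braid
  relation; the three differences of variables are then cancelled.\<close>

lemma divdiff_braid:
  fixes f :: "'k::idom kpoly"
  shows "divdiff i (divdiff (Suc i) (divdiff i f)) = divdiff (Suc i) (divdiff i (divdiff (Suc i) f))"
proof -
  let ?a = "pvar i :: 'k kpoly" and ?b = "pvar (Suc i) :: 'k kpoly" and ?c = "pvar (Suc (Suc i)) :: 'k kpoly"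
  let ?A = "?a - ?b" and ?B = "?b - ?c"
  let ?s = "pswap i" and ?t = "pswap (Suc i)"
  have AB: "?A + ?B = ?a - ?c" by simp
  have sw: "?t ?A = ?a - ?c" "?s ?B = ?a - ?c" "?s (?a - ?c) = ?B" "?t (?a - ?c) = ?A"
    by (simp_all add: sref_other)
  have eqs: "?A * divdiff i g = g - ?s g" "?B * divdiff (Suc i) g = g - ?t g" for g :: "'k kpoly"
    by (rule divdiff_eq)+
  have t1: "(?a - ?c) * ?t (divdiff i g) = ?t g - ?t (?s g)" for g :: "'k kpoly"
  proof -
    have "?t (?A * divdiff i g) = ?t g - ?t (?s g)" unfolding eqs by (rule pswap_simps(7))
    then show ?thesis unfolding pswap_simps(6) sw(1) .
  qed
  have s1: "(?a - ?c) * ?s (divdiff (Suc i) g) = ?s g - ?s (?t g)" for g :: "'k kpoly"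
  proof -
    have "?s (?B * divdiff (Suc i) g) = ?s g - ?s (?t g)" unfolding eqs by (rule pswap_simps(7))
    then show ?thesis unfolding pswap_simps(6) sw(2) .
  qed
  have s2: "?B * ?s (?t (divdiff i g)) = ?s (?t g) - ?s (?t (?s g))" for g :: "'k kpoly"
  proof -
    have "?s ((?a - ?c) * ?t (divdiff i g)) = ?s (?t g) - ?s (?t (?s g))" unfolding t1 by (rule pswap_simps(7))
    then show ?thesis unfolding pswap_simps(6) sw(3) .
  qed
  have t2: "?A * ?t (?s (divdiff (Suc i) g)) = ?t (?s g) - ?t (?s (?t g))" for g :: "'k kpoly"
  proof -
    have "?t ((?a - ?c) * ?s (divdiff (Suc i) g)) = ?t (?s g) - ?t (?s (?t g))" unfolding s1 by (rule pswap_simps(7))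
    then show ?thesis unfolding pswap_simps(6) sw(4) .
  qed
  have "?A * (?B * ((?A + ?B) * divdiff i (divdiff (Suc i) (divdiff i f))))
      = f - ?s f - ?t f + ?t (?s f) + ?s (?t f) - ?s (?t (?s f))"
    by (rule braid_expansion[OF eqs(1) eqs(2) eqs(1) _ _ s2]) (simp_all only: AB t1 s1 pswap_divdiff)
  also have "\<dots> = f - ?t f - ?s f + ?s (?t f) + ?t (?s f) - ?t (?s (?t f))"
    by (simp add: pswap_braid)
  also have "\<dots> = ?B * (?A * ((?B + ?A) * divdiff (Suc i) (divdiff i (divdiff (Suc i) f))))"
    by (rule braid_expansion[OF eqs(2) eqs(1) eqs(2) _ _ t2, symmetric])
      (simp_all only: AB add.commute[of ?B ?A] t1 s1 pswap_divdiff)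
  also have "\<dots> = ?A * (?B * ((?A + ?B) * divdiff (Suc i) (divdiff i (divdiff (Suc i) f))))"
    unfolding mult.left_commute[of ?B ?A] add.commute[of ?B ?A] ..
  finally have "?A * (?B * ((?a - ?c) * divdiff i (divdiff (Suc i) (divdiff i f))))
      = ?A * (?B * ((?a - ?c) * divdiff (Suc i) (divdiff i (divdiff (Suc i) f))))"
    unfolding AB .
  moreover have "?A \<noteq> 0" "?B \<noteq> 0" "?a - ?c \<noteq> 0"
    by (rule pvar_diff_nonzero, simp)+
  ultimately show ?thesis by (simp only: mult_cancel_left simp_thms)
qed

text \<open>Combinations of monomials of degree d dividing the staircase monomial x_1^(n-1) ...
  x_(n-1), so the variable of index n is absent. Schubert polynomials live here, and homogeneity
  turns scaling of the variables into a scalar factor.\<close>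

inductive stair :: "nat \<Rightarrow> nat \<Rightarrow> 'k::comm_ring_1 kpoly \<Rightarrow> bool" for n d where
  zero: "stair n d 0"
| mono: "(\<And>i. i \<in> {1..n} \<Longrightarrow> e i \<le> n - i) \<Longrightarrow> (\<Sum>i\<in>{1..n}. e i) = d \<Longrightarrow>
    stair n d (pconst a * (\<Prod>i\<in>{1..n}. pvar i ^ e i))"
| add: "stair n d f \<Longrightarrow> stair n d g \<Longrightarrow> stair n d (f + g)"

lemma stair_sum: "(\<And>i. i \<in> A \<Longrightarrow> stair n d (f i)) \<Longrightarrow> stair n d (\<Sum>i\<in>A. f i)"
  by (induction A rule: infinite_finite_induct) (auto intro: stair.intros)

lemma stair_const:
  assumes "stair n 0 f"
  shows "\<exists>a. f = pconst a"
  using assms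
proof (induction rule: stair.induct)
  case zero
  then show ?case by (metis pconst_0)
next
  case (mono e a)
  then have "(\<Prod>i\<in>{1..n}. pvar i ^ e i :: 'a kpoly) = 1" by (intro prod.neutral) simp
  then show ?case by (simp only: mult_1_right) blast
next
  case (add f g)
  then show ?case by (metis pconst_add)
qed

lemma stair_psubst:
  assumes "stair n d f" and \<sigma>: "\<And>i. 1 \<le> i \<Longrightarrow> i < n \<Longrightarrow> \<sigma> i = pconst c * \<tau> i"
  shows "psubst \<sigma> f = pconst (c ^ d) * psubst \<tau> f"
  using assms(1)
proof (induction rule: stair.induct)
  case (mono e a)
  have "\<sigma> i ^ e i = pconst c ^ e i * \<tau> i ^ e i" if "i \<in> {1..n}" for i
    using \<sigma>[of i] mono(1)[OF that] that by (cases "i = n") (auto simp: power_mult_distrib)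
  then have "(\<Prod>i\<in>{1..n}. \<sigma> i ^ e i) = pconst (c ^ d) * (\<Prod>i\<in>{1..n}. \<tau> i ^ e i)"
    unfolding mono(2)[symmetric] pconst_power unfolding power_sum by (simp add: prod.distrib)
  then show ?case by (simp add: mult.left_commute)
qed (simp_all add: distrib_left)

lemma prod_pair_remove:
  assumes "1 \<le> i" "i < n"
  shows "(\<Prod>k\<in>{1..n}. h k) = h i * h (Suc i) * (\<Prod>k\<in>{1..n} - {i, Suc i}. h k :: 'a::comm_monoid_mult)"
proof -
  have "(\<Prod>k\<in>{1..n}. h k) = (\<Prod>k\<in>{i, Suc i}. h k) * (\<Prod>k\<in>{1..n} - {i, Suc i}. h k)"
    using assms by (subst mult.commute, intro prod.subset_diff) auto
  then show ?thesis by simp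
qed

lemma sum_pair_remove:
  assumes "1 \<le> i" "i < n"
  shows "(\<Sum>k\<in>{1..n}. h k) = h i + h (Suc i) + (\<Sum>k\<in>{1..n} - {i, Suc i}. h k :: nat)"
proof -
  have "(\<Sum>k\<in>{1..n}. h k) = (\<Sum>k\<in>{i, Suc i}. h k) + (\<Sum>k\<in>{1..n} - {i, Suc i}. h k)"
    using assms by (subst add.commute, intro sum.subset_diff) auto
  then show ?thesis by simp
qed

lemma divdiff_power:
  "divdiff i (pvar i ^ (b + Suc k) * pvar (Suc i) ^ b :: 'k::idom kpoly)
    = (\<Sum>p<Suc k. pvar i ^ (b + p) * pvar (Suc i) ^ (b + (k - p)))"
proof (rule divdiff_unique)
  let ?x = "pvar i :: 'k kpoly" and ?y = "pvar (Suc i) :: 'k kpoly"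
  have "(?x - ?y) * (\<Sum>p<Suc k. ?x ^ (b + p) * ?y ^ (b + (k - p)))
     = (?x ^ b * ?y ^ b) * ((?x - ?y) * (\<Sum>p<Suc k. ?y ^ (Suc k - Suc p) * ?x ^ p))"
    unfolding sum_distrib_left
  proof (rule sum.cong)
    fix p assume "p \<in> {..<Suc k}"
    then obtain r where "k = p + r" by (metis lessThan_iff less_Suc_eq_le le_Suc_ex)
    then show "(?x - ?y) * (?x ^ (b + p) * ?y ^ (b + (k - p)))
        = ?x ^ b * ?y ^ b * ((?x - ?y) * (?y ^ (Suc k - Suc p) * ?x ^ p))"
      by (simp add: power_add algebra_simps)
  qed simp
  also have "(?x - ?y) * (\<Sum>p<Suc k. ?y ^ (Suc k - Suc p) * ?x ^ p) = ?x ^ Suc k - ?y ^ Suc k"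
    by (rule power_diff_sumr2[symmetric])
  finally show "(?x - ?y) * (\<Sum>p<Suc k. ?x ^ (b + p) * ?y ^ (b + (k - p)))
     = ?x ^ (b + Suc k) * ?y ^ b - pswap i (?x ^ (b + Suc k) * ?y ^ b)"
    by (simp add: power_add algebra_simps)
qed

text \<open>Only the exponents of \<open>pvar i\<close> and \<open>pvar (Suc i)\<close> change, and
  the new ones are strictly below the larger of the old ones. That one is at most n - i, so even the
  bound n - i - 1 of the second variable is respected.\<close>

lemma stair_divdiff:
  fixes f :: "'k::idom kpoly"
  assumes "stair n d f" and i: "1 \<le> i" "i < n"
  shows "stair n (d - 1) (divdiff i f)"
  using assms(1)
proof (induction rule: stair.induct)
  case (mono e a)
  let ?x = "pvar i :: 'k kpoly" and ?y = "pvar (Suc i) :: 'k kpoly"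
  define R where "R = pconst a * (\<Prod>k\<in>{1..n} - {i, Suc i}. pvar k ^ e k :: 'k kpoly)"
  have f: "pconst a * (\<Prod>i\<in>{1..n}. pvar i ^ e i) = R * (?x ^ e i * ?y ^ e (Suc i))"
    unfolding prod_pair_remove[OF i] R_def by (simp add: algebra_simps)
  have "pswap i R = R"
    unfolding R_def by (auto simp: sref_other intro!: prod.cong)
  moreover have "divdiff i R = 0" by (rule divdiff_symmetric) fact
  ultimately have df: "divdiff i (pconst a * (\<Prod>i\<in>{1..n}. pvar i ^ e i)) = R * divdiff i (?x ^ e i * ?y ^ e (Suc i))"
    unfolding f by (simp add: divdiff_mult)
  have main: "stair n (d - 1) (pconst c * (R * divdiff i (?x ^ (b + Suc k) * ?y ^ b)))"
    if bk: "b + k + b + 1 = e i + e (Suc i)" "b + k \<le> n - Suc i" for b k c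
  proof -
    have "stair n (d - 1) (pconst c * (R * (?x ^ (b + p) * ?y ^ (b + (k - p)))))" if p: "p \<in> {..<Suc k}" for p
    proof -
      define e' where "e' = e(i := b + p, Suc i := b + (k - p))"
      have "pconst c * (R * (?x ^ (b + p) * ?y ^ (b + (k - p)))) = pconst (c * a) * (\<Prod>k\<in>{1..n}. pvar k ^ e' k)"
      proof -
        have "(\<Prod>k\<in>{1..n} - {i, Suc i}. pvar k ^ e k :: 'k kpoly) = (\<Prod>k\<in>{1..n} - {i, Suc i}. pvar k ^ e' k)"
          by (rule prod.cong) (auto simp: e'_def)
        moreover have "e' i = b + p" "e' (Suc i) = b + (k - p)" by (simp_all add: e'_def)
        ultimately show ?thesis
          unfolding prod_pair_remove[OF i] R_def by (simp add: pconst_mult algebra_simps)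
      qed
      moreover have "stair n (d - 1) (pconst (c * a) * (\<Prod>k\<in>{1..n}. pvar k ^ e' k))"
      proof (rule stair.mono)
        fix j assume j: "j \<in> {1..n}"
        then show "e' j \<le> n - j" using mono(1)[OF j] bk p i by (auto simp: e'_def)
      next
        have "(\<Sum>k\<in>{1..n} - {i, Suc i}. e' k) = (\<Sum>k\<in>{1..n} - {i, Suc i}. e k)"
          by (rule sum.cong) (auto simp: e'_def)
        then show "(\<Sum>k\<in>{1..n}. e' k) = d - 1"
          using mono(2) p bk unfolding sum_pair_remove[OF i] by (simp add: e'_def)
      qed
      ultimately show ?thesis by (simp only:)
    qed
    then show ?thesis
      unfolding divdiff_power sum_distrib_left by (rule stair_sum)
  qed
  consider "e i = e (Suc i)" | "e i > e (Suc i)" | "e i < e (Suc i)" by linarith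
  then show ?case
  proof cases
    case 1
    have "divdiff i (?x ^ e i * ?y ^ e (Suc i)) = 0"
      by (rule divdiff_symmetric) (simp add: 1 mult.commute)
    then show ?thesis unfolding df by (simp add: stair.zero)
  next
    case 2
    then obtain k where k: "e i = e (Suc i) + Suc k" using less_imp_Suc_add by fastforce
    have "stair n (d - 1) (pconst 1 * (R * divdiff i (?x ^ (e (Suc i) + Suc k) * ?y ^ e (Suc i))))"
      using mono(1)[of i] i k by (intro main) auto
    then show ?thesis unfolding df by (simp add: k)
  next
    case 3
    then obtain k where k: "e (Suc i) = e i + Suc k" using less_imp_Suc_add by fastforce
    have "?x ^ e i * ?y ^ e (Suc i) = pswap i (?x ^ (e i + Suc k) * ?y ^ e i)"
      by (simp add: k mult.commute)
    then have "R * divdiff i (?x ^ e i * ?y ^ e (Suc i)) = pconst (- 1) * (R * divdiff i (?x ^ (e i + Suc k) * ?y ^ e i))"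
      by (simp only: divdiff_pswap pconst_uminus pconst_1) simp
    moreover have "stair n (d - 1) (pconst (- 1) * (R * divdiff i (?x ^ (e i + Suc k) * ?y ^ e i)))"
      using mono(1)[of "Suc i"] i k by (intro main) auto
    ultimately show ?thesis unfolding df by (simp only:)
  qed
qed (simp_all add: stair.intros divdiff_add)

lemma stair_staircase: "stair n (\<Sum>i\<in>{1..n}. n - i) (\<Prod>i\<in>{1..<n}. pvar i ^ (n - i))"
proof -
  have "(\<Prod>i\<in>{1..n}. pvar i ^ (n - i) :: 'a kpoly) = (\<Prod>i\<in>{1..<n}. pvar i ^ (n - i))"
    by (rule prod.mono_neutral_right) auto
  moreover have "stair n (\<Sum>i\<in>{1..n}. n - i) (pconst 1 * (\<Prod>i\<in>{1..n}. pvar i ^ (n - i) :: 'a kpoly))"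
    by (rule stair.mono) auto
  ultimately show ?thesis by (simp only: pconst_1 mult_1)
qed

subsection \<open>Divided differences modulo the relations\<close>

lemma in_klideal_mult_diff:
  assumes "in_klideal q (d * (f - f'))" "in_klideal q (d * (g - g'))"
  shows "in_klideal q (d * (f * g - f' * g'))"
proof -
  have "d * (f * g - f' * g') = g * (d * (f - f')) + f' * (d * (g - g'))"
    by (simp add: algebra_simps)
  then show ?thesis using assms by (simp add: in_klideal_add in_klideal_mult)
qed

lemma in_klideal_psubst_diff:
  assumes "\<And>j. in_klideal q (d * (\<sigma> j - \<tau> j))"
  shows "in_klideal q (d * (psubst \<sigma> f - psubst \<tau> f))"
proof (induction f rule: kpoly_induct)
  case (add f g)
  have "d * (psubst \<sigma> (f + g) - psubst \<tau> (f + g)) = d * (psubst \<sigma> f - psubst \<tau> f) + d * (psubst \<sigma> g - psubst \<tau> g)"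
    by (simp add: algebra_simps)
  then show ?case using add by (simp only: in_klideal_add)
next
  case (mult f g)
  then show ?case by (simp only: psubst_mult in_klideal_mult_diff)
qed (use assms in simp_all)

text \<open>The increment of a polynomial along \<open>c\<close> only depends on the base point modulo the annihilator
  of \<open>c\<close>.\<close>

lemma in_klideal_increment:
  assumes c: "\<And>j. in_klideal q (c * (\<sigma> j - \<tau> j))"
  shows "\<exists>h k. psubst (\<lambda>j. \<sigma> j + c * \<epsilon> j) f - psubst \<sigma> f = c * h \<and>
    psubst (\<lambda>j. \<tau> j + c * \<epsilon> j) f - psubst \<tau> f = c * k \<and> in_klideal q (c * (h - k))"
    (is "\<exists>h k. ?P f h k")
proof (induction f rule: kpoly_induct)
  case (const a)
  show ?case by (rule exI[of _ 0] exI)+ simp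
next
  case (var i)
  show ?case by (rule exI[of _ "\<epsilon> i"])+ simp
next
  case (add f g)
  then obtain h k h' k' where *: "?P f h k" "?P g h' k'" by blast
  have "in_klideal q (c * (h - k) + c * (h' - k'))" using * by (simp add: in_klideal_add)
  then have "?P (f + g) (h + h') (k + k')" using * by (simp add: algebra_simps)
  then show ?case by blast
next
  case (mult f g)
  then obtain h k h' k' where *: "?P f h k" "?P g h' k'" by blast
  let ?F = "psubst (\<lambda>j. \<sigma> j + c * \<epsilon> j)" and ?f = "psubst \<sigma>"
  let ?K = "psubst (\<lambda>j. \<tau> j + c * \<epsilon> j)" and ?k = "psubst \<tau>"
  have FK: "in_klideal q (c * (?F g - ?K g))"
    by (rule in_klideal_psubst_diff) (use c in \<open>simp add: algebra_simps\<close>)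
  have fk: "in_klideal q (c * (?f f - ?k f))"
    by (rule in_klideal_psubst_diff[OF c])
  have "in_klideal q (c * (h * ?F g - k * ?K g) + c * (?f f * h' - ?k f * k'))"
    by (intro in_klideal_add in_klideal_mult_diff FK fk) (use * in simp_all)
  then have I: "in_klideal q (c * ((h * ?F g + ?f f * h') - (k * ?K g + ?k f * k')))"
    by (simp add: algebra_simps)
  have "?F (f * g) - ?f (f * g) = (?F f - ?f f) * ?F g + ?f f * (?F g - ?f g)"
    by (simp add: algebra_simps)
  also have "\<dots> = c * (h * ?F g + ?f f * h')"
    using * by (simp add: algebra_simps)
  finally have 1: "?F (f * g) - ?f (f * g) = c * (h * ?F g + ?f f * h')" .
  have "?K (f * g) - ?k (f * g) = (?K f - ?k f) * ?K g + ?k f * (?K g - ?k g)"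
    by (simp add: algebra_simps)
  also have "\<dots> = c * (k * ?K g + ?k f * k')"
    using * by (simp add: algebra_simps)
  finally have 2: "?K (f * g) - ?k (f * g) = c * (k * ?K g + ?k f * k')" .
  from 1 2 I show ?case by blast
qed

text \<open>When a and b agree after multiplication by c, moving the increment c from slot
  \<open>Suc i\<close> to slot i costs c times the divided difference at the old point.\<close>

lemma in_klideal_divdiff_step:
  fixes f :: "'k::idom kpoly"
  assumes c: "in_klideal q (c * (a - b))"
  shows "in_klideal q (psubst (y(i := a + c, Suc i := b)) f
     - psubst (y(i := a, Suc i := b + c)) f - c * psubst (y(i := a, Suc i := b + c)) (divdiff i f))"
proof -
  define E where "E p r g = psubst (y(i := p, Suc i := r)) g" for p r and g :: "'k kpoly"
  have sw: "E p r (pswap i g) = E r p g" for p r g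
  proof -
    have "(y(i := p, Suc i := r)) \<circ> sref i = y(i := r, Suc i := p)"
      by (auto simp: fun_eq_iff sref_def transpose_def)
    then show ?thesis by (simp add: E_def psubst_pswap)
  qed
  have dd: "(p - r) * E p r (divdiff i f) = E p r f - E r p f" for p r
  proof -
    have "E p r ((pvar i - pvar (Suc i)) * divdiff i f) = E p r f - E p r (pswap i f)"
      unfolding divdiff_eq by (simp add: E_def)
    then show ?thesis by (simp only: sw) (simp add: E_def)
  qed
  \<comment> \<open>The two points differ by c in one slot, and c times a - b is in the
    ideal.\<close>
  have I1: "in_klideal q ((a - b) * (E a (b + c) (divdiff i f) - E a b (divdiff i f)))"
    unfolding E_def by (rule in_klideal_psubst_diff) (use c in \<open>simp add: mult.commute\<close>)
  \<comment> \<open>Adding c to slot i gives the same increment at (b, a) as at (a, b), because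
    these points agree after multiplication by c.\<close>
  have I2: "in_klideal q ((E (b + c) a f - E b a f) - (E (a + c) b f - E a b f))"
  proof -
    let ?e = "\<lambda>j. if j = i then 1 else 0 :: 'k kpoly"
    have sub: "(\<lambda>j. (y(i := p, Suc i := r)) j + c * ?e j) = y(i := p + c, Suc i := r)" for p r
      by (auto simp: fun_eq_iff)
    have "in_klideal q (c * ((y(i := b, Suc i := a)) j - (y(i := a, Suc i := b)) j))" for j
    proof -
      have "in_klideal q (c * (b - a))" using in_klideal_uminus[OF c] by (simp add: algebra_simps)
      then show ?thesis using c by simp
    qed
    from in_klideal_increment[where q = q and c = c and \<sigma> = "y(i := b, Suc i := a)" and \<tau> = "y(i := a, Suc i := b)"
        and \<epsilon> = ?e and f = f, OF this] obtain h k where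
      "E (b + c) a f - E b a f = c * h" "E (a + c) b f - E a b f = c * k" "in_klideal q (c * (h - k))"
      unfolding sub E_def by blast
    then show ?thesis by (simp add: right_diff_distrib)
  qed
  have "E (a + c) b f - E a (b + c) f - c * E a (b + c) (divdiff i f)
     = (E (a + c) b f - E a (b + c) f) - (a - b) * E a (b + c) (divdiff i f) + (a - (b + c)) * E a (b + c) (divdiff i f)"
    by (simp add: algebra_simps)
  also have "\<dots> = - ((a - b) * (E a (b + c) (divdiff i f) - E a b (divdiff i f)))
      - ((E (b + c) a f - E b a f) - (E (a + c) b f - E a b f))"
    unfolding right_diff_distrib[of "a - b"] dd by simp
  finally show ?thesis
    using in_klideal_diff[OF in_klideal_uminus[OF I1] I2] by (simp only: E_def)
qed

text \<open>For \<open>q = 1\<close>, the operator \<open>f \<mapsto> \<Sum>\<^sub>i u\<^sub>i \<partial>\<^sub>i f\<close> is a derivation modulo the relations that fixes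
  the \<open>x\<^sub>j\<close>: it multiplies by the degree.\<close>

lemma in_klideal_euler:
  fixes f :: "'k::idom kpoly"
  assumes "stair n d f"
  shows "in_klideal 1 (of_nat d * psubst xv f - (\<Sum>i\<in>{1..<n}. zv i * psubst xv (divdiff i f)))"
proof -
  define E where "E f = (\<Sum>i\<in>{1..<n}. zv i * psubst xv (divdiff i f))" for f :: "'k kpoly"
  define eul where "eul d f \<longleftrightarrow> in_klideal 1 (of_nat d * psubst xv f - E f)" for d and f :: "'k kpoly"
  have E_add: "E (f + g) = E f + E g" for f g
    by (simp add: E_def divdiff_add distrib_left sum.distrib)
  have const: "eul 0 (pconst a)" for a
    by (simp add: eul_def E_def)
  have var: "eul 1 (pvar j)" if "1 \<le> j" "j < n" for j
  proof -
    have "E (pvar j) = (\<Sum>i\<in>{1..<n}. (if i = j then zv i else 0) - (if i = j - 1 then zv i else 0))"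
      unfolding E_def using that by (intro sum.cong) (auto simp: divdiff_var)
    also have "\<dots> = zv j - zv (j - 1)"
    proof -
      have "(\<Sum>i\<in>{1..<n}. if i = j - 1 then zv i else 0) = (zv (j - 1) :: 'k kpoly)"
        using that by (cases "j = 1") (auto simp: sum.delta)
      then show ?thesis unfolding sum_subtractf using that by simp
    qed
    finally show ?thesis by (simp add: eul_def xv_def)
  qed
  have mult: "eul (d + e) (f * g)" if "eul d f" "eul e g" for d e f g
  proof -
    \<comment> \<open>The defect of the product rule consists of multiples of \<open>zv i\<close>
      times the change of f under the swap of slots i and i + 1. For q = 1 multiplication by
      \<open>zv i\<close> identifies \<open>xv i\<close> with \<open>xv (Suc i)\<close>, so it lies
      in the ideal.\<close>
    have E_mult: "in_klideal 1 (E (f * g) - (E f * psubst xv g + psubst xv f * E g))"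
    proof -
      have "E (f * g) - (E f * psubst xv g + psubst xv f * E g)
         = (\<Sum>i\<in>{1..<n}. psubst xv (divdiff i g) * (zv i * (psubst (xv \<circ> sref i) f - psubst xv f)))"
        unfolding E_def sum_distrib_left sum_distrib_right sum.distrib[symmetric] sum_subtractf[symmetric]
        by (rule sum.cong) (auto simp: divdiff_mult psubst_pswap algebra_simps)
      moreover have "in_klideal 1 (zv i * (psubst (xv \<circ> sref i) f - psubst xv f))" for i
      proof (rule in_klideal_psubst_diff)
        fix j
        have I: "in_klideal 1 (zv i * (xv (Suc i) - xv i :: 'k kpoly))"
          using in_klideal_x[of 1 i] by simp
        consider "j = i" | "j = Suc i" | "j \<noteq> i" "j \<noteq> Suc i" by blast
        then show "in_klideal 1 (zv i * ((xv \<circ> sref i) j - xv j :: 'k kpoly))"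
        proof cases
          case 2
          then show ?thesis using in_klideal_uminus[OF I] by (simp add: algebra_simps)
        qed (use I in \<open>simp_all add: sref_other\<close>)
      qed
      ultimately show ?thesis by (simp only: in_klideal_sum in_klideal_mult)
    qed
    have "of_nat (d + e) * psubst xv (f * g) - E (f * g)
      = psubst xv g * (of_nat d * psubst xv f - E f) + psubst xv f * (of_nat e * psubst xv g - E g)
        - (E (f * g) - (E f * psubst xv g + psubst xv f * E g))"
      by (simp add: algebra_simps)
    then show ?thesis
      using that E_mult unfolding eul_def by (simp only: in_klideal_add in_klideal_diff in_klideal_mult)
  qed
  have one: "eul 0 1" using const[of 1] by simp
  have pow: "eul k (pvar j ^ k)" if "1 \<le> j" "j < n" for j k
  proof (induction k)
    case (Suc k)
    then show ?case using mult[OF var[OF that] Suc] by simp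
  qed (simp add: one)
  have prod: "eul (\<Sum>i\<in>A. e i) (\<Prod>i\<in>A. pvar i ^ e i)" if "finite A" "\<And>i. i \<in> A \<Longrightarrow> e i = 0 \<or> (1 \<le> i \<and> i < n)" for A e
    using that
  proof (induction A rule: finite_induct)
    case (insert x A)
    have "eul (e x) (pvar x ^ e x)" using insert.prems[of x] pow[of x "e x"] one by auto
    then show ?case using insert mult by simp
  qed (simp add: one)
  have "eul d f"
    using assms
  proof (induction rule: stair.induct)
    case zero
    show ?case by (simp add: eul_def E_def)
  next
    case (mono e a)
    have "eul (\<Sum>i\<in>{1..n}. e i) (\<Prod>i\<in>{1..n}. pvar i ^ e i)"
    proof (rule prod)
      fix i assume i: "i \<in> {1..n}"
      then show "e i = 0 \<or> (1 \<le> i \<and> i < n)" using mono(1)[OF i] by (cases "i = n") auto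
    qed simp
    then show ?case using mult[OF const[of a]] mono(2) by simp
  next
    case (add f g)
    have "of_nat d * psubst xv (f + g) - E (f + g) = (of_nat d * psubst xv f - E f) + (of_nat d * psubst xv g - E g)"
      by (simp add: E_add algebra_simps)
    then show ?case using add.IH unfolding eul_def by (simp only: in_klideal_add)
  qed
  then show ?thesis by (simp add: eul_def E_def)
qed

subsection \<open>Inversions and reduced words\<close>

definition invs :: "(nat \<Rightarrow> nat) \<Rightarrow> (nat \<times> nat) set" where
  "invs w = {(a, b). a < b \<and> w b < w a}"

definition ninv :: "(nat \<Rightarrow> nat) \<Rightarrow> nat" where
  "ninv w = card (invs w)"

lemma sref_less: "a < b \<Longrightarrow> (a, b) \<noteq> (i, Suc i) \<Longrightarrow> sref i a < sref i b"
  by (auto simp: sref_def transpose_def split: if_splits)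

lemma comp_sref_sref [simp]: "w \<circ> sref i \<circ> sref i = w"
  by (simp add: fun_eq_iff)

text \<open>The swap relabels positions and preserves the order of every pair of positions except
  (i, i + 1), so only that inversion is new.\<close>

lemma invs_comp_sref:
  assumes "w i < w (Suc i)"
  shows "invs (w \<circ> sref i) = insert (i, Suc i) (map_prod (sref i) (sref i) ` invs w)"
proof (intro set_eqI iffI)
  fix x assume x: "x \<in> invs (w \<circ> sref i)"
  obtain a b where ab: "x = (a, b)" by (cases x)
  show "x \<in> insert (i, Suc i) (map_prod (sref i) (sref i) ` invs w)"
  proof (cases "(a, b) = (i, Suc i)")
    case False
    have "(sref i a, sref i b) \<in> invs w"
      using x ab sref_less[OF _ False] by (auto simp: invs_def)
    then have "map_prod (sref i) (sref i) (sref i a, sref i b) \<in> map_prod (sref i) (sref i) ` invs w"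
      by (rule imageI)
    then show ?thesis by (simp add: ab)
  qed (simp add: ab)
next
  fix x assume "x \<in> insert (i, Suc i) (map_prod (sref i) (sref i) ` invs w)"
  then consider "x = (i, Suc i)" | a b where "x = (sref i a, sref i b)" "(a, b) \<in> invs w" by auto
  then show "x \<in> invs (w \<circ> sref i)"
  proof cases
    case 2
    then have "(a, b) \<noteq> (i, Suc i)" using assms by (auto simp: invs_def)
    then show ?thesis using 2 sref_less by (auto simp: invs_def)
  qed (use assms in \<open>simp add: invs_def\<close>)
qed

lemma inj_sref_pair: "inj_on (map_prod (sref i) (sref i)) A"
  by (rule inj_onI) (auto, (metis sref_sref)+)

lemma finite_invs_comp_sref:
  assumes "w i < w (Suc i)"
  shows "finite (invs (w \<circ> sref i)) \<longleftrightarrow> finite (invs w)"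
  unfolding invs_comp_sref[OF assms] by (simp add: finite_image_iff[OF inj_sref_pair])

lemma ninv_comp_sref_ascent:
  assumes "finite (invs w)" "w i < w (Suc i)"
  shows "ninv (w \<circ> sref i) = Suc (ninv w)"
proof -
  have "(i, Suc i) \<notin> map_prod (sref i) (sref i) ` invs w"
  proof
    assume "(i, Suc i) \<in> map_prod (sref i) (sref i) ` invs w"
    then obtain x where x: "(i, Suc i) = map_prod (sref i) (sref i) x" "x \<in> invs w" by (rule imageE)
    obtain a b where "x = (a, b)" by (cases x)
    with x(2) x(1)[symmetric] have "sref i a = i" "sref i b = Suc i" "a < b"
      by (simp_all add: invs_def)
    then have "a = Suc i" "b = i" by (metis sref_sref sref_simps)+
    then show False using \<open>a < b\<close> by simp
  qed
  then show ?thesis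
    unfolding ninv_def invs_comp_sref[OF assms(2)] using assms(1) by (simp add: card_image[OF inj_sref_pair])
qed

lemma ninv_comp_sref_descent:
  assumes "finite (invs w)" "w (Suc i) < w i"
  shows "ninv w = Suc (ninv (w \<circ> sref i))" "finite (invs (w \<circ> sref i))"
proof -
  have a: "(w \<circ> sref i) i < (w \<circ> sref i) (Suc i)" using assms(2) by simp
  show f: "finite (invs (w \<circ> sref i))"
    using finite_invs_comp_sref[of "w \<circ> sref i", OF a] assms(1) by (simp only: comp_sref_sref)
  show "ninv w = Suc (ninv (w \<circ> sref i))"
    using ninv_comp_sref_ascent[of "w \<circ> sref i", OF f a] by (simp only: comp_sref_sref)
qed

lemma word_prod_snoc: "word_prod (a @ [i]) = word_prod a \<circ> sref i"
  unfolding word_prod_def by (induction a) (simp_all add: o_assoc)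

text \<open>Each letter changes the number of inversions by one. Consequently a word whose length
  equals the number of inversions of its product is reduced.\<close>

lemma word_prod_inversions:
  "inj (word_prod a) \<and> finite (invs (word_prod a)) \<and> ninv (word_prod a) \<le> length a"
proof (induction a rule: rev_induct)
  case Nil
  have "word_prod [] = id" "invs id = {}" by (auto simp: word_prod_def invs_def)
  then show ?case unfolding ninv_def by (simp only: inj_on_id card.empty finite.emptyI le0 simp_thms)
next
  case (snoc i a)
  let ?w = "word_prod a"
  have "inj (sref i)" by (metis injI sref_sref)
  then have inj: "inj (?w \<circ> sref i)" using snoc by (intro inj_compose) auto
  have "?w i \<noteq> ?w (Suc i)" using snoc by (metis injD n_not_Suc_n)
  then consider "?w i < ?w (Suc i)" | "?w (Suc i) < ?w i" by linarith
  then show ?case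
  proof cases
    case 1
    then show ?thesis using snoc inj finite_invs_comp_sref[OF 1] ninv_comp_sref_ascent[OF _ 1]
      unfolding word_prod_snoc by (simp del: o_apply)
  next
    case 2
    then show ?thesis using snoc inj ninv_comp_sref_descent[OF _ 2]
      unfolding word_prod_snoc by (simp del: o_apply)
  qed
qed

section \<open>Permutations of an initial segment\<close>

lemma permutes_ge_1:
  assumes "w permutes {1..n}" "1 \<le> i" "i \<le> n"
  shows "1 \<le> w i" "w i \<le> n"
  using permutes_in_image[OF assms(1), of i] assms(2,3) by auto

lemma invs_permutes_subset:
  assumes "w permutes {1..n}"
  shows "invs w \<subseteq> {1..n} \<times> {1..n}"
proof
  fix x assume "x \<in> invs w"
  then obtain a b where x: "x = (a, b)" and ab: "a < b" "w b < w a" by (auto simp: invs_def)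
  have out: "w i = i" if "i \<notin> {1..n}" for i using assms that by (rule permutes_not_in)
  have "b \<le> n"
  proof (rule ccontr)
    assume "\<not> b \<le> n"
    then show False using ab out[of a] out[of b] permutes_ge_1[OF assms, of a] by (cases "a \<in> {1..n}") auto
  qed
  moreover have "1 \<le> a" using ab out[of 0] by (cases a) auto
  ultimately show "x \<in> {1..n} \<times> {1..n}" using x ab by auto
qed

lemma finite_invs_permutes: "w permutes {1..n} \<Longrightarrow> finite (invs w)"
  using invs_permutes_subset finite_subset by blast

lemma ninv_le: "w permutes {1..n} \<Longrightarrow> ninv w \<le> n * n"
  unfolding ninv_def using card_mono[OF _ invs_permutes_subset, of n w] by simp

text \<open>Since w fixes everything outside the segment, w and its inverse increase strictly on all
  naturals, and both therefore dominate the identity.\<close>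

lemma increasing_permutes_id:
  assumes w: "w permutes {1..n}" and inc: "\<And>i. 1 \<le> i \<Longrightarrow> i < n \<Longrightarrow> w i < w (Suc i)"
  shows "w = id"
proof -
  have out: "w i = i" if "i \<notin> {1..n}" for i using w that by (rule permutes_not_in)
  have "w i < w (Suc i)" for i
  proof -
    consider "i = 0" | "1 \<le> i" "i < n" | "i = n" "1 \<le> i" | "i > n" by linarith
    then show ?thesis
    proof cases
      case 1
      then show ?thesis using out[of 0] out[of 1] permutes_ge_1[OF w, of 1] by (cases "n = 0") auto
    next
      case 3
      then show ?thesis using out[of "Suc n"] permutes_ge_1[OF w, of n] by auto
    qed (use inc out in auto)
  qed
  then have mono: "strict_mono w" by (simp add: strict_mono_Suc_iff)
  have "inv w (w x) = x" "w (inv w x) = x" for x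
    using w by (simp_all add: permutes_inverses)
  then have "strict_mono (inv w)"
    using mono by (intro strict_monoI) (metis strict_mono_less)
  then have "x \<le> w x" "x \<le> inv w x" for x
    using mono by (auto intro: strict_mono_imp_increasing)
  then have "w x = x" for x
    using \<open>\<And>x. w (inv w x) = x\<close> mono by (metis antisym strict_mono_less_eq)
  then show ?thesis by auto
qed

lemma ninv_0_id:
  assumes "w permutes {1..n}" "ninv w = 0"
  shows "w = id"
proof (rule increasing_permutes_id[OF assms(1)])
  fix i
  have "invs w = {}" using assms finite_invs_permutes by (simp add: ninv_def)
  then have "(i, Suc i) \<notin> invs w" by simp
  moreover have "w i \<noteq> w (Suc i)" using permutes_inj[OF assms(1)] by (metis injD n_not_Suc_n)
  ultimately show "w i < w (Suc i)" by (auto simp: invs_def)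
qed

lemma permutes_comp_sref: "w permutes {1..n} \<Longrightarrow> 1 \<le> i \<Longrightarrow> i < n \<Longrightarrow> w \<circ> sref i permutes {1..n}"
  unfolding sref_def by (intro permutes_compose permutes_swap_id) auto

lemma longest_longest: "longest n (longest n i) = i"
  by (auto simp: longest_def)

lemma longest_permutes: "longest n permutes {1..n}"
proof (rule bij_imp_permutes)
  show "bij_betw (longest n) {1..n} {1..n}"
    by (rule bij_betw_byWitness[of _ "longest n"]) (auto simp: longest_def)
qed (auto simp: longest_def)

lemma ninv_longest: "ninv (longest n) = (\<Sum>i\<in>{1..n}. n - i)"
proof -
  have "invs (longest n) = Sigma {1..n} (\<lambda>a. {a<..n})"
  proof
    show "invs (longest n) \<subseteq> Sigma {1..n} (\<lambda>a. {a<..n})"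
      using invs_permutes_subset[OF longest_permutes] by (fastforce simp: invs_def)
  qed (auto simp: invs_def longest_def)
  then show ?thesis by (simp add: ninv_def card_SigmaI)
qed

subsection \<open>Schubert polynomials\<close>

text \<open>The longest permutation has as many inversions as the staircase monomial has degree, and
  each step lowers both numbers by one.\<close>

lemma schub_rel_stair:
  fixes P :: "'k::idom kpoly"
  assumes "schub_rel n w P"
  shows "w permutes {1..n} \<and> stair n (ninv w) P"
  using assms
proof (induction rule: schub_rel.induct)
  case base
  then show ?case using longest_permutes stair_staircase by (simp only: ninv_longest) simp
next
  case (step w P i)
  have "w (Suc i) < w i" using step by simp
  then have "ninv w = Suc (ninv (w \<circ> sref i))"
    using ninv_comp_sref_descent finite_invs_permutes step.IH by blast
  then have "stair n (ninv (w \<circ> sref i)) (divdiff i P)"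
    using stair_divdiff[of n "ninv w" P i] step by (simp del: o_apply)
  then show ?case using permutes_comp_sref step by blast
qed

lemma schub_rel_ascent:
  assumes "schub_rel n (w \<circ> sref i) R" "1 \<le> i" "i < n" "w i < w (Suc i)"
  shows "schub_rel n w (divdiff i R)"
  using schub_rel.step[OF assms(1), of i] assms(2-4) by simp

lemma schub_rel_invert:
  assumes "schub_rel n w P"
  shows "(w = longest n \<and> P = (\<Prod>i\<in>{1..<n}. pvar i ^ (n - i))) \<or>
    (\<exists>i R. 1 \<le> i \<and> i < n \<and> w i < w (Suc i) \<and> schub_rel n (w \<circ> sref i) R \<and> P = divdiff i R)"
  using assms
proof (cases rule: schub_rel.cases)
  case (step v R i)
  then have "w i < w (Suc i) \<and> schub_rel n (w \<circ> sref i) R" by simp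
  then show ?thesis using step by blast
qed simp

lemma longest_descent: "1 \<le> i \<Longrightarrow> i < n \<Longrightarrow> \<not> longest n i < longest n (Suc i)"
  by (simp add: longest_def)

text \<open>Climbing along ascents raises the number of inversions, which is at most n * n. It stops
  at a permutation without ascents, and that is the longest one.\<close>

lemma schub_rel_exists:
  "w permutes {1..n} \<Longrightarrow> \<exists>P :: 'k::comm_ring_1 kpoly. schub_rel n w P"
proof (induction "n * n - ninv w" arbitrary: w rule: less_induct)
  case less
  show ?case
  proof (cases "\<exists>i. 1 \<le> i \<and> i < n \<and> w i < w (Suc i)")
    case True
    then obtain i where i: "1 \<le> i" "i < n" "w i < w (Suc i)" by blast
    have p: "w \<circ> sref i permutes {1..n}" using less.prems i by (intro permutes_comp_sref)
    have "ninv (w \<circ> sref i) = Suc (ninv w)"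
      using less.prems i by (intro ninv_comp_sref_ascent finite_invs_permutes)
    then have "n * n - ninv (w \<circ> sref i) < n * n - ninv w"
      using ninv_le[OF p] by simp
    from less.hyps[OF this p] show ?thesis using schub_rel_ascent i by blast
  next
    case False
    have "w \<circ> longest n = id"
    proof (rule increasing_permutes_id)
      show "w \<circ> longest n permutes {1..n}"
        using longest_permutes less.prems by (rule permutes_compose)
      fix i assume i: "1 \<le> i" "i < n"
      have "\<not> w (n - i) < w (Suc (n - i))" using False i by simp
      moreover have "w (n - i) \<noteq> w (Suc (n - i))"
        using permutes_inj[OF less.prems] by (metis injD n_not_Suc_n)
      ultimately show "(w \<circ> longest n) i < (w \<circ> longest n) (Suc i)"
        using i by (simp add: longest_def Suc_diff_le)
    qed
    then have "w = longest n"
      by (metis comp_apply ext id_apply longest_longest)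
    then show ?thesis using schub_rel.base by blast
  qed
qed

text \<open>Local confluence: two ascents at \<open>i\<close> and \<open>j\<close> close up by the commutation or the braid relation
  of the divided differences.\<close>

lemma schub_rel_unique:
  fixes P Q :: "'k::idom kpoly"
  assumes "schub_rel n w P" "schub_rel n w Q"
  shows "P = Q"
  using assms
proof (induction "n * n - ninv w" arbitrary: w P Q rule: less_induct)
  case less
  have w: "w permutes {1..n}" using schub_rel_stair less.prems by blast
  have IH: "R = S" if "1 \<le> i" "i < n" "w i < w (Suc i)" "schub_rel n (w \<circ> sref i) R" "schub_rel n (w \<circ> sref i) S"
    for i and R S :: "'k kpoly"
  proof (rule less.hyps[OF _ that(4,5)])
    have p: "w \<circ> sref i permutes {1..n}" using w that by (intro permutes_comp_sref)
    have "ninv (w \<circ> sref i) = Suc (ninv w)"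
      using w that by (intro ninv_comp_sref_ascent finite_invs_permutes)
    then show "n * n - ninv (w \<circ> sref i) < n * n - ninv w"
      using ninv_le[OF p] by simp
  qed
  have conf: "divdiff i R = divdiff j S"
    if i: "1 \<le> i" "i < n" "w i < w (Suc i)" "schub_rel n (w \<circ> sref i) R"
      and j: "1 \<le> j" "j < n" "w j < w (Suc j)" "schub_rel n (w \<circ> sref j) S" and ij: "i < j"
    for i j and R S :: "'k kpoly"
  proof (cases "j = Suc i")
    case True
    let ?k = "Suc i"
    have "w \<circ> sref i \<circ> sref ?k \<circ> sref i permutes {1..n}"
      using w i j True by (intro permutes_comp_sref) auto
    \<comment> \<open>T belongs to the common upper bound of the two ascents. The induction
      hypothesis identifies R and S with the polynomials reached from T along the two sides of the
      hexagon.\<close>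
    then obtain T :: "'k kpoly" where T: "schub_rel n (w \<circ> sref i \<circ> sref ?k \<circ> sref i) T"
      using schub_rel_exists by blast
    have o: "sref ?k i = i" "sref i (Suc ?k) = Suc ?k"
      by (simp_all add: sref_other)
    have T1: "schub_rel n (w \<circ> sref i \<circ> sref ?k) (divdiff i T)"
      by (rule schub_rel_ascent[OF T]) (use i j True in \<open>auto simp: o\<close>)
    have 1: "schub_rel n (w \<circ> sref i) (divdiff ?k (divdiff i T))"
      by (rule schub_rel_ascent[OF T1]) (use i j True in \<open>auto simp: o\<close>)
    have "w \<circ> sref i \<circ> sref ?k \<circ> sref i = w \<circ> sref ?k \<circ> sref i \<circ> sref ?k"
    proof
      fix x
      have "sref i (sref ?k (sref i x)) = sref ?k (sref i (sref ?k x))"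
        by (simp add: sref_def transpose_def)
      then show "(w \<circ> sref i \<circ> sref ?k \<circ> sref i) x = (w \<circ> sref ?k \<circ> sref i \<circ> sref ?k) x"
        by simp
    qed
    with T have T': "schub_rel n (w \<circ> sref ?k \<circ> sref i \<circ> sref ?k) T" by (simp only:)
    have T2: "schub_rel n (w \<circ> sref ?k \<circ> sref i) (divdiff ?k T)"
      by (rule schub_rel_ascent[OF T']) (use i j True in \<open>auto simp: o\<close>)
    have 2: "schub_rel n (w \<circ> sref ?k) (divdiff i (divdiff ?k T))"
      by (rule schub_rel_ascent[OF T2]) (use i j True in \<open>auto simp: o\<close>)
    show ?thesis
      using IH[OF i 1] IH[OF j, of "divdiff i (divdiff ?k T)"] 2 True by (simp add: divdiff_braid)
  next
    case False
    then have lt: "Suc i < j" using ij by simp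
    have "w \<circ> sref i \<circ> sref j permutes {1..n}"
      using w i j by (intro permutes_comp_sref) auto
    then obtain T :: "'k kpoly" where T: "schub_rel n (w \<circ> sref i \<circ> sref j) T"
      using schub_rel_exists by blast
    have o: "sref j i = i" "sref j (Suc i) = Suc i" "sref i j = j" "sref i (Suc j) = Suc j"
      using lt by (simp_all add: sref_other)
    have 1: "schub_rel n (w \<circ> sref i) (divdiff j T)"
      by (rule schub_rel_ascent[OF T]) (use i j in \<open>auto simp: o\<close>)
    have "w \<circ> sref i \<circ> sref j = w \<circ> sref j \<circ> sref i"
      using lt by (auto simp: fun_eq_iff sref_def transpose_def)
    with T have T': "schub_rel n (w \<circ> sref j \<circ> sref i) T" by (simp only:)
    have 2: "schub_rel n (w \<circ> sref j) (divdiff i T)"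
      by (rule schub_rel_ascent[OF T']) (use i j in \<open>auto simp: o\<close>)
    show ?thesis
      using IH[OF i 1] IH[OF j 2] divdiff_commute[OF lt] by simp
  qed
  show ?case
  proof (cases "w = longest n")
    case True
    then show ?thesis
      using schub_rel_invert[OF less.prems(1)] schub_rel_invert[OF less.prems(2)] longest_descent by blast
  next
    case False
    obtain i R where i: "1 \<le> i" "i < n" "w i < w (Suc i)" "schub_rel n (w \<circ> sref i) R" and P: "P = divdiff i R"
      using schub_rel_invert[OF less.prems(1)] False by blast
    obtain j S where j: "1 \<le> j" "j < n" "w j < w (Suc j)" "schub_rel n (w \<circ> sref j) S" and Q: "Q = divdiff j S"
      using schub_rel_invert[OF less.prems(2)] False by blast
    consider "i = j" | "i < j" | "j < i" by linarith
    then show ?thesis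
    proof cases
      case 1
      then show ?thesis using IH[OF i] j P Q by simp
    next
      case 2
      then show ?thesis using conf[OF i j] P Q by simp
    next
      case 3
      then show ?thesis using conf[OF j i] P Q by simp
    qed
  qed
qed

lemma schubert_rel:
  fixes w :: "nat \<Rightarrow> nat"
  assumes "w permutes {1..n}"
  shows "schub_rel n w (schubert n w :: 'k::idom kpoly)"
  unfolding schubert_def using schub_rel_exists[OF assms] schub_rel_unique
  by (metis (no_types, lifting) theI')

lemma schubert_eqI:
  fixes P :: "'k::idom kpoly"
  shows "schub_rel n w P \<Longrightarrow> schubert n w = P"
  using schub_rel_unique schub_rel_stair schubert_rel by blast

text \<open>At a descent this is the defining step. At an ascent the polynomial is itself a divided
  difference at i, and the operator squares to 0.\<close>

lemma divdiff_schubert: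
  assumes w: "w permutes {1..n}" and i: "1 \<le> i" "i < n"
  shows "divdiff i (schubert n w :: 'k::idom kpoly)
    = (if w (Suc i) < w i then schubert n (w \<circ> sref i) else 0)"
proof (cases "w (Suc i) < w i")
  case True
  have "schub_rel n (w \<circ> sref i) (divdiff i (schubert n w :: 'k kpoly))"
    using schub_rel.step[OF schubert_rel[OF w] i] True by simp
  then show ?thesis using True by (simp add: schubert_eqI)
next
  case False
  moreover have "w i \<noteq> w (Suc i)"
    using permutes_inj[OF w] by (metis injD n_not_Suc_n)
  ultimately have "w i < w (Suc i)" by simp
  then have "schub_rel n w (divdiff i (schubert n (w \<circ> sref i) :: 'k kpoly))"
    using permutes_comp_sref[OF w i] schubert_rel i by (intro schub_rel_ascent) auto
  then have "schubert n w = (divdiff i (schubert n (w \<circ> sref i)) :: 'k kpoly)"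
    by (rule schubert_eqI)
  then show ?thesis using False by (simp add: divdiff_divdiff)
qed

subsection \<open>Expansion of Schubert polynomials into reduced words\<close>

definition word_gens :: "(nat \<Rightarrow> nat) \<Rightarrow> 'k::comm_ring_1 kpoly set" where
  "word_gens w = {prod_list (map zv a) |a. (\<forall>i\<in>set a. 1 \<le> i) \<and> word_prod a = w \<and> length a = ninv w}"

lemma kspan_word_gens_zv:
  assumes "kspan q (word_gens (w \<circ> sref i)) f" "finite (invs w)" "w (Suc i) < w i" "1 \<le> i"
  shows "kspan q (word_gens w) (zv i * f)"
proof (rule kspan_image[OF assms(1)])
  fix g :: "'a kpoly" assume "g \<in> word_gens (w \<circ> sref i)"
  then obtain a where g: "g = prod_list (map zv a)" and a: "\<forall>i\<in>set a. 1 \<le> i"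
    "word_prod a = w \<circ> sref i" "length a = ninv (w \<circ> sref i)"
    unfolding word_gens_def by blast
  have "zv i * g = prod_list (map zv (a @ [i]))"
    by (simp add: g mult.commute)
  moreover have "\<forall>i\<in>set (a @ [i]). 1 \<le> i" "word_prod (a @ [i]) = w" "length (a @ [i]) = ninv w"
    using a assms(4) ninv_comp_sref_descent[OF assms(2,3)] by (auto simp: word_prod_snoc)
  ultimately have "zv i * g \<in> word_gens w"
    unfolding word_gens_def by blast
  then show "kspan q (word_gens w) (zv i * g)" by (rule kspan.gen)
qed

text \<open>\<open>shift_point q k\<close> passes from \<open>x\<close> at \<open>k = 0\<close> to \<open>q x\<close> at large \<open>k\<close>; the
  \<open>k\<close>-th step is governed by \<open>\<partial>\<^sub>k\<close>.\<close>

definition shift_point :: "'k::comm_ring_1 \<Rightarrow> nat \<Rightarrow> nat \<Rightarrow> 'k kpoly" where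
  "shift_point q k j = (if j \<le> k then pconst q * xv j
     else if j = Suc k then pconst (1 - q) * zv k + xv j else xv j)"

lemma shift_point_0: "shift_point q 0 = xv"
  by (auto simp: shift_point_def fun_eq_iff)

text \<open>The increment (1 - q) times \<open>zv (Suc k)\<close> moves between slots
  \<open>Suc k\<close> and \<open>Suc (Suc k)\<close>, whose base values q \<open>xv (Suc k)\<close>
  and \<open>xv (Suc (Suc k))\<close> agree next to \<open>zv (Suc k)\<close>. Adding it to the
  first base value gives (1 - q) \<open>zv k\<close> + \<open>xv (Suc k)\<close>, the entry of the
  previous point.\<close>

lemma in_klideal_shift_point:
  fixes f :: "'k::idom kpoly"
  shows "in_klideal q (psubst (shift_point q k) f - psubst (shift_point q (Suc k)) f
    - pconst (1 - q) * (zv (Suc k) * psubst (shift_point q (Suc k)) (divdiff (Suc k) f)))"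
proof -
  let ?i = "Suc k" and ?y = "shift_point q (Suc k)"
  let ?a = "pconst q * xv ?i" and ?b = "xv (Suc ?i) :: 'k kpoly" and ?c = "pconst (1 - q) * zv ?i"
  have "in_klideal q (- pconst (1 - q) * (zv ?i * (xv (Suc ?i) - pconst q * xv ?i)))"
    by (intro in_klideal_mult in_klideal_x)
  then have "in_klideal q (?c * (?a - ?b))" by (simp add: algebra_simps)
  note step = in_klideal_divdiff_step[OF this, of ?y ?i f]
  have "?y(?i := ?a, Suc ?i := ?b + ?c) = ?y"
    by (auto simp: fun_eq_iff shift_point_def)
  moreover have "?y(?i := ?a + ?c, Suc ?i := ?b) = shift_point q k"
  proof
    fix j
    have "?a + ?c = pconst (1 - q) * zv k + xv ?i"
      by (simp add: xv_def pconst_diff algebra_simps)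
    then show "(?y(?i := ?a + ?c, Suc ?i := ?b)) j = shift_point q k j"
      by (simp add: shift_point_def)
  qed
  ultimately show ?thesis using step by (simp only: mult.assoc)
qed

lemma kspan_schubert:
  fixes q :: "'k::field_char_0"
  assumes q: "\<forall>n::nat. n > 0 \<longrightarrow> q ^ n = 1 \<longrightarrow> q = 1" and "w permutes {1..n}"
  shows "kspan q (word_gens w) (psubst xv (schubert n w))"
  using assms(2)
proof (induction "ninv w" arbitrary: w rule: less_induct)
  case less
  note w = less.prems
  let ?S = "schubert n :: (nat \<Rightarrow> nat) \<Rightarrow> 'k kpoly"
  have stair: "stair n (ninv v) (?S v)" if "v permutes {1..n}" for v
    using schubert_rel[OF that] schub_rel_stair by blast
  \<comment> \<open>The divided difference is 0 or belongs to a shorter permutation, whose reduced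
    words are completed by the letter i. The evaluation point is arbitrary so that shifted points
    are covered too.\<close>
  have descent: "kspan q (word_gens v) (zv i * psubst \<sigma> (divdiff i (?S v)))"
    if v: "v permutes {1..n}" and i: "1 \<le> i" "i < n"
      and \<sigma>: "\<And>u. u permutes {1..n} \<Longrightarrow> ninv u < ninv v \<Longrightarrow> kspan q (word_gens u) (psubst \<sigma> (?S u))"
    for v i \<sigma>
  proof (cases "v (Suc i) < v i")
    case True
    have fin: "finite (invs v)" using finite_invs_permutes[OF v] .
    have "kspan q (word_gens (v \<circ> sref i)) (psubst \<sigma> (?S (v \<circ> sref i)))"
      using ninv_comp_sref_descent(1)[OF fin True] permutes_comp_sref[OF v i] by (intro \<sigma>) auto
    then show ?thesis
      using kspan_word_gens_zv[OF _ fin True] i True by (simp add: divdiff_schubert[OF v i])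
  next
    case False
    then show ?thesis by (simp add: divdiff_schubert[OF v i] kspan.zero)
  qed
  show ?case
  proof (cases "ninv w = 0")
    case True
    then have "w = id" using ninv_0_id[OF w] by simp
    have "prod_list (map zv []) \<in> (word_gens w :: 'k kpoly set)"
      unfolding word_gens_def using True \<open>w = id\<close> by (intro CollectI exI[of _ "[]"]) (simp add: word_prod_def)
    then have "kspan q (word_gens w) 1" using kspan.gen[of 1] by simp
    moreover obtain a where "?S w = pconst a"
      using stair_const stair[OF w] True by auto
    ultimately show ?thesis using kspan.scale[of q "word_gens w" 1 a] by simp
  next
    case False
    show ?thesis
    proof (cases "q = 1")
      case True
      have "kspan q (word_gens w) (\<Sum>i\<in>{1..<n}. zv i * psubst xv (divdiff i (?S w)))"
        by (intro kspan_sum descent[OF w]) (auto intro: less.hyps)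
      then have "kspan q (word_gens w) (pconst (of_nat (ninv w)) * psubst xv (?S w))"
        by (rule kspan.cong) (use in_klideal_euler[OF stair[OF w]] True in \<open>simp only: pconst_of_nat\<close>)
      then show ?thesis by (rule kspan_cancel_const) (use False in simp)
    next
      case q1: False
      have "n \<noteq> 0"
      proof
        assume "n = 0"
        then have "ninv w \<le> 0" using ninv_le[OF w] by simp
        then show False using False by simp
      qed
      then obtain N where N: "n = Suc N" by (cases n) auto
      \<comment> \<open>With N = n - 1 every variable that occurs has been multiplied by q, and
        homogeneity extracts the power of q.\<close>
      have last: "psubst (shift_point q N) (?S v) = pconst (q ^ ninv v) * psubst xv (?S v)"
        if "v permutes {1..n}" for v
        by (rule stair_psubst[OF stair[OF that]]) (simp add: shift_point_def N)
      \<comment> \<open>For shorter permutations the claim is known at x, hence at the last shifted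
        point up to a power of q. From there it is carried back from k = N to smaller k.\<close>
      have lower: "kspan q (word_gens v) (psubst (shift_point q k) (?S v))"
        if "k \<le> N" "v permutes {1..n}" "ninv v < ninv w" for k v
        using that
      proof (induction k arbitrary: v rule: inc_induct)
        case base
        then show ?case by (simp add: last less.hyps kspan.scale)
      next
        case (step k)
        have "kspan q (word_gens v) (zv (Suc k) * psubst (shift_point q (Suc k)) (divdiff (Suc k) (?S v)))"
          using step by (intro descent) (auto simp: N)
        from kspan.add[OF step.IH[OF step.prems] kspan.scale[OF this, of "1 - q"]] show ?case
          by (rule kspan.cong) (use in_klideal_shift_point[of q k "?S v"] in \<open>simp add: algebra_simps\<close>)
      qed
      \<comment> \<open>Telescoping over the first k shifts, where each increment involves only
        shorter permutations. At k = N the difference is 1 - q^l times the value sought, with l the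
        number of inversions of w.\<close>
      have "kspan q (word_gens w) (psubst xv (?S w) - psubst (shift_point q k) (?S w))" if "k \<le> N" for k
        using that
      proof (induction k)
        case 0
        show ?case by (simp add: shift_point_0 kspan.zero)
      next
        case (Suc k)
        have "kspan q (word_gens w) (zv (Suc k) * psubst (shift_point q (Suc k)) (divdiff (Suc k) (?S w)))"
          using Suc lower by (intro descent[OF w]) (auto simp: N)
        from kspan.add[OF Suc.IH kspan.scale[OF this, of "1 - q"]] show ?case
          by (rule kspan.cong) (use Suc.prems in_klideal_shift_point[of q k "?S w"] in \<open>simp_all add: algebra_simps\<close>)
      qed
      from this[of N] have "kspan q (word_gens w) (pconst (1 - q ^ ninv w) * psubst xv (?S w))"
        by (simp add: last[OF w] pconst_diff algebra_simps)
      moreover have "1 - q ^ ninv w \<noteq> 0" using q q1 False by auto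
      ultimately show ?thesis by (rule kspan_cancel_const)
    qed
  qed
qed

lemma prod_list_map_eq_prod_count:
  "prod_list (map f xs) = (\<Prod>x\<in>set xs. f x ^ count_list xs x :: 'a::comm_monoid_mult)"
proof (induction xs)
  case (Cons x xs)
  show ?case
  proof (cases "x \<in> set xs")
    case True
    have "(\<Prod>y\<in>set xs. f y ^ count_list (x # xs) y) = f x * (\<Prod>y\<in>set xs. f y ^ count_list xs y)"
    proof -
      have "(\<Prod>y\<in>set xs - {x}. f y ^ count_list (x # xs) y) = (\<Prod>y\<in>set xs - {x}. f y ^ count_list xs y)"
        by (rule prod.cong) auto
      then show ?thesis using True by (simp add: prod.remove[of _ x] mult.assoc)
    qed
    then show ?thesis using Cons True by (simp add: insert_absorb)
  next
    case False
    have "(\<Prod>y\<in>set xs. f y ^ count_list (x # xs) y) = (\<Prod>y\<in>set xs. f y ^ count_list xs y)"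
      using False by (intro prod.cong) auto
    then show ?thesis using Cons False by (simp add: count_list_0_iff)
  qed
qed simp

text \<open>The words in the expansion have length equal to the number of inversions, hence are
  reduced and have quasi-Lukasiewicz content. By commutativity the monomial of a word depends only
  on its content.\<close>

lemma kspan_quasi_luk_perm:
  fixes q :: "'k::field_char_0"
  assumes q: "\<forall>n::nat. n > 0 \<longrightarrow> q ^ n = 1 \<longrightarrow> q = 1" and w: "w permutes {1..n}" "quasi_luk_perm w"
  shows "kspan q interval_gens (delta_plus (schubert n w))"
  unfolding delta_plus_eq
proof (rule kspan_mono[OF kspan_schubert[OF q w(1)]])
  fix g :: "'k kpoly" assume "g \<in> word_gens w"
  then obtain a where g: "g = prod_list (map zv a)" and a: "\<forall>i\<in>set a. 1 \<le> i" "word_prod a = w" "length a = ninv w"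
    unfolding word_gens_def by blast
  have "reduced_word w a"
    unfolding reduced_word_def using a word_prod_inversions by metis
  then have luk: "quasi_luk (cont a)" using w(2) by (simp add: quasi_luk_perm_def)
  have "{j. cont a j \<noteq> 0} = set a" by (auto simp: cont_def count_list_0_iff)
  then have "g = (\<Prod>i\<in>{j. cont a j \<noteq> 0}. zv i ^ cont a i)"
    by (simp add: g prod_list_map_eq_prod_count cont_def)
  then show "kspan q interval_gens g" using quasi_luk_interval_span[OF q luk] by simp
qed

theorem mainTheorem20:
  fixes q :: "'k::field_char_0"
  assumes "\<forall>n::nat. n > 0 \<longrightarrow> q ^ n = 1 \<longrightarrow> q = 1"
  shows "(\<forall>c :: nat \<Rightarrow>\<^sub>0 nat. quasi_luk (Poly_Mapping.lookup c) \<longrightarrow>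
            weak_interval q (Poly_Mapping.single c (1::'k)))
       \<and> (\<forall>(m::nat) (P :: 'k kpoly). m \<ge> 1 \<and> quasisym m P \<longrightarrow> weak_interval q (delta_plus P))
       \<and> (\<forall>(n::nat) (w :: nat \<Rightarrow> nat). w permutes {1..n} \<and> quasi_luk_perm w \<longrightarrow>
            weak_interval q (delta_plus (schubert n w :: 'k kpoly)))"
  using kspan_quasi_luk_single[OF assms] kspan_quasisym[OF assms] kspan_quasi_luk_perm[OF assms]
  by (blast intro: weak_interval_if_kspan)

end
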